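(* Let $P\in\mathbb{C}\{x,y\}$ with $P(0,0)=0$ and $P(0,y)\not\equiv0$, and suppose that $P$ has no zeros in $U\cap(\mathbb{R}\times(\mathbb{C}\setminus\mathbb{R}))$ for some neighborhood $U$ of $(0,0)$. Then, near $(0,0)$, the zero set of $P$ is a finite union of smooth curves $\{y=\phi(x)\}$ where each $\phi\in\mathbb{R}\{x\}$ is a convergent power series with real coefficients and $\phi(0)=0$; equivalently $P=u\prod_{j=1}^{M}(y-\phi_j(x))$ with $u$ a unit, $M=\mathrm{Ord}(P(0,y))$, and $\phi_j\in\mathbb{R}\{x\}$.
   Context: $\mathbb{C}\{x,y\}$ is the ring of convergent power series at the origin; $\mathbb{R}\{x\}$ denotes convergent power series in $x$ with real coefficients. A unit is a series not vanishing at the origin. Ord denotes order of vanishing at $0$. *)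

theory Defs
  imports "HOL-Analysis.Analysis"
begin

text \<open>A convergent power series in two complex variables, given by its coefficients
  a i j (coefficient of x^i y^j): it converges absolutely on some polydisc of radius r > 0.\<close>
definition conv2 :: "(nat \<Rightarrow> nat \<Rightarrow> complex) \<Rightarrow> bool" where
  "conv2 a \<longleftrightarrow> (\<exists>r>0. (\<lambda>(i,j). norm (a i j) * r ^ (i + j)) summable_on UNIV)"

definition ps2 :: "(nat \<Rightarrow> nat \<Rightarrow> complex) \<Rightarrow> complex \<Rightarrow> complex \<Rightarrow> complex" where
  "ps2 a x y = infsum (\<lambda>(i,j). a i j * x ^ i * y ^ j) UNIV"

definition conv1 :: "(nat \<Rightarrow> real) \<Rightarrow> bool" where
  "conv1 c \<longleftrightarrow> (\<exists>r>0. summable (\<lambda>n. \<bar>c n\<bar> * r ^ n))"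

definition ps1 :: "(nat \<Rightarrow> real) \<Rightarrow> complex \<Rightarrow> complex" where
  "ps1 c x = (\<Sum>n. complex_of_real (c n) * x ^ n)"

definition ord_y0 :: "(nat \<Rightarrow> nat \<Rightarrow> complex) \<Rightarrow> nat" where
  "ord_y0 a = (LEAST j. a 0 j \<noteq> 0)"

end

theory Submission
  imports Defs "HOL-Complex_Analysis.Complex_Analysis"
begin

text \<open>
  By induction on \<open>M = Ord P(0,y)\<close> it suffices to find one real analytic root \<open>\<phi>\<close> and to divide by
  \<open>y - \<phi>(x)\<close>. For small \<open>x\<close> let \<open>y\<^sub>1(x), \<dots>, y\<^sub>M(x)\<close> be the roots of \<open>P(x,\<cdot>)\<close> near \<open>0\<close>. Their power sums
  are circle integrals of the logarithmic derivative, hence holomorphic in \<open>x\<close>; so are the mean \<open>\<mu>\<close>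
  and the variance \<open>v = \<Sum>(y\<^sub>i - \<mu>)\<^sup>2\<close>. For real \<open>x\<close> the roots are real, so \<open>v \<ge> 0\<close> there. If \<open>v\<close> vanishes
  identically, \<open>\<mu>\<close> is a root. Otherwise \<open>v\<close> has even order \<open>2k\<close> at \<open>0\<close>, so \<open>y\<^sub>i - \<mu> = O(x\<^sup>k)\<close> on the real
  axis, and \<open>Q(x,z) = P(x, \<mu>(x) + x\<^sup>k z) / x\<^bsup>kM\<^esup>\<close> is holomorphic. The roots of \<open>Q(0,\<cdot>)\<close> are limits of
  the rescaled roots \<open>(y\<^sub>i - \<mu>) / x\<^sup>k\<close>: they are real, have sum zero and a nonzero sum of squares, so they
  do not all coincide. Hence \<open>Q\<close> vanishes to some order between \<open>1\<close> and \<open>M - 1\<close> at each of them, and a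
  root of \<open>Q\<close> obtained by induction yields a root of \<open>P\<close>. This replaces the Newton-Puiseux theorem.
\<close>

section \<open>Circle integrals and separately holomorphic functions\<close>

text \<open>The obstacle is that the roots are merely chosen for each x, in no coherent order, so no
  continuity in x is available for a single root. Only symmetric expressions in them are
  holomorphic. This is why P is described locally by the power sums of its roots together with two
  inequalities comparing |P(x,y)| with the product of the |y - y_i|: such inequalities survive
  rescaling and passage to a limit, and so locate the zeros of Q(0,.) without any theorem on
  continuity of roots. Evenness of the order of v keeps the scaling exponent an integer, which is
  how fractional powers of x are excluded. The estimate on y_i - \<mu> holds for real x only, but an
  order of vanishing can be tested along a real sequence, so divisibility by a power of x follows
  for complex x as well. The reality hypothesis does not pass to Q for free: at x = 0 the rescaling
  is degenerate, and nonreal zeros of Q(0,.) near the chosen root are excluded by shrinking until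
  that root is isolated.\<close>

lemma continuous_on_contour_integral_circlepath:
  fixes g :: "'a::topological_space \<Rightarrow> complex \<Rightarrow> complex"
  assumes g: "continuous_on (T \<times> sphere z r) (\<lambda>p. g (fst p) (snd p))" and "0 \<le> r"
  shows "continuous_on T (\<lambda>t. contour_integral (circlepath z r) (g t))"
proof -
  have c: "continuous_on (T \<times> cbox 0 1) (\<lambda>p. (fst p, circlepath z r (snd p)))"
    unfolding circlepath by (intro continuous_intros)
  have "circlepath z r t \<in> sphere z r" if "t \<in> {0..1}" for t
    using that path_image_circlepath_nonneg[OF \<open>0 \<le> r\<close>, of z] by (metis image_eqI path_image_def)
  then have "continuous_on (T \<times> cbox 0 1) (\<lambda>p. g (fst p) (circlepath z r (snd p)))"
    using continuous_on_compose2[OF g c] by fastforce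
  then have "continuous_on (T \<times> cbox 0 1) (\<lambda>(t, s). g t (circlepath z r s) *
               vector_derivative (circlepath z r) (at s))"
    unfolding vector_derivative_circlepath case_prod_beta by (intro continuous_intros)
  from integral_continuous_on_param[OF this] show ?thesis
    by (simp add: contour_integral_integral)
qed

text \<open>Morera's theorem: over a triangle the two integrations may be interchanged, and the
  inner integral of the function \<open>\<lambda>x. g x w\<close> vanishes by Cauchy's
  theorem.\<close>

lemma holomorphic_on_contour_integral_circlepath:
  assumes "open A" and "0 \<le> r"
    and g: "continuous_on (A \<times> sphere z r) (\<lambda>p. g (fst p) (snd p))"
    and hol: "\<And>w. w \<in> sphere z r \<Longrightarrow> (\<lambda>x. g x w) holomorphic_on A"
  shows "(\<lambda>x. contour_integral (circlepath z r) (g x)) holomorphic_on A"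
proof -
  let ?c = "circlepath z r"
  let ?H = "\<lambda>x. contour_integral ?c (g x)"
  have contH: "continuous_on A ?H"
    by (rule continuous_on_contour_integral_circlepath[OF g \<open>0 \<le> r\<close>])
  have im: "path_image ?c = sphere z r"
    using assms by simp
  have "?H analytic_on A"
  proof (rule Morera_triangle[OF contH \<open>open A\<close>], rule impI)
    fix a b c assume abc: "convex hull {a, b, c} \<subseteq> A"
    have seg: "closed_segment a b \<subseteq> A" "closed_segment b c \<subseteq> A" "closed_segment c a \<subseteq> A"
      by (rule subset_trans[OF _ abc], simp add: closed_segment_subset_convex_hull hull_inc)+
    have swap: "contour_integral (linepath u v) ?H =
                contour_integral ?c (\<lambda>w. contour_integral (linepath u v) (\<lambda>x. g x w))"
      if "closed_segment u v \<subseteq> A" for u v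
    proof (rule contour_integral_swap)
      show "continuous_on (path_image (linepath u v) \<times> path_image ?c) (\<lambda>(x, w). g x w)"
        unfolding case_prod_beta by (rule continuous_on_subset[OF g]) (use that im in auto)
      show "continuous_on {0..1} (\<lambda>t. vector_derivative ?c (at t))"
        unfolding vector_derivative_circlepath by (intro continuous_intros)
    qed auto
    \<comment> \<open>After the interchange the three sides give three integrals over the circle;
      they can be merged into one only if each integrand is integrable there.\<close>
    have ci: "(\<lambda>w. contour_integral (linepath u v) (\<lambda>x. g x w)) contour_integrable_on ?c"
      if "closed_segment u v \<subseteq> A" for u v
    proof (rule contour_integrable_continuous_circlepath)
      have c: "continuous_on (sphere z r \<times> cbox 0 1) (\<lambda>p. (linepath u v (snd p), fst p))"
        unfolding linepath_def by (intro continuous_intros)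
      have "linepath u v t \<in> A" if "t \<in> {0..1}" for t
        using that \<open>closed_segment u v \<subseteq> A\<close> by (metis image_eqI path_image_def path_image_linepath subsetD)
      then have "continuous_on (sphere z r \<times> cbox 0 1) (\<lambda>p. g (linepath u v (snd p)) (fst p))"
        using continuous_on_compose2[OF g c] by fastforce
      then have "continuous_on (sphere z r \<times> cbox 0 1)
                   (\<lambda>(w, t). g (linepath u v t) w * vector_derivative (linepath u v) (at t))"
        unfolding case_prod_beta by (simp, intro continuous_intros)
      from integral_continuous_on_param[OF this]
      show "continuous_on (path_image ?c) (\<lambda>w. contour_integral (linepath u v) (\<lambda>x. g x w))"
        unfolding im by (simp add: contour_integral_integral)
    qed
    have zero: "contour_integral (linepath a b) (\<lambda>x. g x w) + contour_integral (linepath b c) (\<lambda>x. g x w)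
           + contour_integral (linepath c a) (\<lambda>x. g x w) = 0" if "w \<in> sphere z r" for w
    proof -
      have "(\<lambda>x. g x w) holomorphic_on (convex hull {a, b, c})"
        using hol[OF that] abc holomorphic_on_subset by blast
      from Cauchy_theorem_triangle[OF this]
      have "contour_integral (linepath a b +++ linepath b c +++ linepath c a) (\<lambda>x. g x w) = 0"
        by (rule contour_integral_unique)
      moreover have "continuous_on A (\<lambda>x. g x w)"
        using hol[OF that] holomorphic_on_imp_continuous_on by blast
      then have "(\<lambda>x. g x w) contour_integrable_on linepath u v" if "closed_segment u v \<subseteq> A" for u v
        using that contour_integrable_continuous_linepath continuous_on_subset by blast
      ultimately show ?thesis using seg by (simp add: add.assoc)
    qed
    show "contour_integral (linepath a b) ?H + contour_integral (linepath b c) ?H +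
          contour_integral (linepath c a) ?H = 0"
      unfolding swap[OF seg(1)] swap[OF seg(2)] swap[OF seg(3)]
      using zero im
      by (subst contour_integral_add[symmetric], intro ci seg, intro ci seg)
         (subst contour_integral_add[symmetric], intro contour_integrable_add ci seg, intro ci seg,
          subst contour_integral_eq[where g = "\<lambda>_. 0"], auto)
  qed
  then show ?thesis
    by (rule analytic_imp_holomorphic)
qed

text \<open>By Osgood's lemma these are exactly the holomorphic functions of two variables when \<open>A\<close> and \<open>B\<close>
  are open.\<close>
definition hol2 :: "(complex \<Rightarrow> complex \<Rightarrow> complex) \<Rightarrow> complex set \<Rightarrow> complex set \<Rightarrow> bool" where
  "hol2 F A B \<longleftrightarrow> continuous_on (A \<times> B) (\<lambda>p. F (fst p) (snd p)) \<and>
     (\<forall>x\<in>A. F x holomorphic_on B) \<and> (\<forall>y\<in>B. (\<lambda>x. F x y) holomorphic_on A)"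

lemma hol2_continuous: "hol2 F A B \<Longrightarrow> continuous_on (A \<times> B) (\<lambda>p. F (fst p) (snd p))"
  and hol2_snd: "hol2 F A B \<Longrightarrow> x \<in> A \<Longrightarrow> F x holomorphic_on B"
  and hol2_fst: "hol2 F A B \<Longrightarrow> y \<in> B \<Longrightarrow> (\<lambda>x. F x y) holomorphic_on A"
  by (auto simp: hol2_def)

lemma hol2_continuous_compose:
  assumes "hol2 F A B" "continuous_on S f" "continuous_on S g"
    "\<And>s. s \<in> S \<Longrightarrow> f s \<in> A" "\<And>s. s \<in> S \<Longrightarrow> g s \<in> B"
  shows "continuous_on S (\<lambda>s. F (f s) (g s))"
  using continuous_on_compose2[OF hol2_continuous[OF assms(1)] continuous_on_Pair[OF assms(2,3)]] assms(4,5)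
  by (auto simp: image_subset_iff)

lemma hol2_subset: "hol2 F A B \<Longrightarrow> A' \<subseteq> A \<Longrightarrow> B' \<subseteq> B \<Longrightarrow> hol2 F A' B'"
  unfolding hol2_def by (meson Sigma_mono continuous_on_subset holomorphic_on_subset subsetD)

lemma hol2_flip:
  assumes "hol2 F A B"
  shows "hol2 (\<lambda>x y. F y x) B A"
proof -
  have "continuous_on (B \<times> A) (\<lambda>p. F (snd p) (fst p))"
    by (intro hol2_continuous_compose[OF assms] continuous_intros) auto
  then show ?thesis
    using assms by (simp add: hol2_def)
qed

lemma hol2_cong:
  assumes "hol2 F A B" "\<And>x y. x \<in> A \<Longrightarrow> y \<in> B \<Longrightarrow> F x y = G x y"
  shows "hol2 G A B"
  unfolding hol2_def
proof (intro conjI ballI)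
  show "continuous_on (A \<times> B) (\<lambda>p. G (fst p) (snd p))"
    by (rule continuous_on_eq[OF hol2_continuous[OF assms(1)]]) (use assms(2) in auto)
  show "G x holomorphic_on B" if "x \<in> A" for x
    by (rule holomorphic_transform[OF hol2_snd[OF assms(1) that]]) (use assms(2) that in auto)
  show "(\<lambda>x. G x y) holomorphic_on A" if "y \<in> B" for y
    by (rule holomorphic_transform[OF hol2_fst[OF assms(1) that]]) (use assms(2) that in auto)
qed

text \<open>The common tool for derivatives, composites and quotients below: each is written as an
  integral over a fixed circle whose kernel visibly has the required regularity in both
  parameters.\<close>

lemma hol2_circle_integral:
  assumes "open A" "open B" "0 \<le> r"
    and c: "continuous_on ((A \<times> B) \<times> sphere z r) (\<lambda>p. g (fst (fst p)) (snd (fst p)) (snd p))"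
    and h1: "\<And>y w. y \<in> B \<Longrightarrow> w \<in> sphere z r \<Longrightarrow> (\<lambda>x. g x y w) holomorphic_on A"
    and h2: "\<And>x w. x \<in> A \<Longrightarrow> w \<in> sphere z r \<Longrightarrow> (\<lambda>y. g x y w) holomorphic_on B"
  shows "hol2 (\<lambda>x y. contour_integral (circlepath z r) (g x y)) A B"
  unfolding hol2_def
proof (intro conjI ballI)
  show "continuous_on (A \<times> B) (\<lambda>p. contour_integral (circlepath z r) (g (fst p) (snd p)))"
    by (rule continuous_on_contour_integral_circlepath) (use c \<open>0 \<le> r\<close> in auto)
  show "(\<lambda>y. contour_integral (circlepath z r) (g x y)) holomorphic_on B" if "x \<in> A" for x
  proof (rule holomorphic_on_contour_integral_circlepath[OF \<open>open B\<close> \<open>0 \<le> r\<close> _ h2[OF that]])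
    have "continuous_on (B \<times> sphere z r) (\<lambda>p. ((x, fst p), snd p))"
      by (intro continuous_intros)
    from continuous_on_compose2[OF c this]
    show "continuous_on (B \<times> sphere z r) (\<lambda>p. g x (fst p) (snd p))" using that by (auto simp: image_subset_iff)
  qed
  show "(\<lambda>x. contour_integral (circlepath z r) (g x y)) holomorphic_on A" if "y \<in> B" for y
  proof (rule holomorphic_on_contour_integral_circlepath[OF \<open>open A\<close> \<open>0 \<le> r\<close> _ h1[OF that]])
    have "continuous_on (A \<times> sphere z r) (\<lambda>p. ((fst p, y), snd p))"
      by (intro continuous_intros)
    from continuous_on_compose2[OF c this]
    show "continuous_on (A \<times> sphere z r) (\<lambda>p. g (fst p) y (snd p))" using that by (auto simp: image_subset_iff)
  qed
qed

text \<open>A Cauchy representation is valid only on a disc whose boundary circle stays inside the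
  domain, so the results below are obtained near each point and patched together here.\<close>

lemma hol2_local:
  assumes "open A" "open B"
    and loc: "\<And>x y. x \<in> A \<Longrightarrow> y \<in> B \<Longrightarrow>
      \<exists>A' B'. open A' \<and> open B' \<and> x \<in> A' \<and> y \<in> B' \<and> hol2 F A' B'"
  shows "hol2 F A B"
  unfolding hol2_def
proof (intro conjI ballI)
  show "continuous_on (A \<times> B) (\<lambda>p. F (fst p) (snd p))"
  proof (rule continuous_at_imp_continuous_on, clarify)
    fix x y assume "x \<in> A" "y \<in> B"
    from loc[OF this] obtain A' B' where "open A'" "open B'" "x \<in> A'" "y \<in> B'" "hol2 F A' B'" by blast
    then show "isCont (\<lambda>p. F (fst p) (snd p)) (x, y)"
      using continuous_on_eq_continuous_at[of "A' \<times> B'"] hol2_continuous[of F A' B']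
      by (auto simp: open_Times)
  qed
  show "F x holomorphic_on B" if "x \<in> A" for x
    unfolding holomorphic_on_def
  proof (intro ballI)
    fix y assume "y \<in> B"
    from loc[OF that this] obtain A' B' where "open A'" "open B'" "x \<in> A'" "y \<in> B'" "hol2 F A' B'" by blast
    then have "F x field_differentiable at y"
      using hol2_snd holomorphic_on_imp_differentiable_at by blast
    then show "F x field_differentiable at y within B"
      by (rule field_differentiable_at_within)
  qed
  show "(\<lambda>x. F x y) holomorphic_on A" if "y \<in> B" for y
    unfolding holomorphic_on_def
  proof (intro ballI)
    fix x assume "x \<in> A"
    from loc[OF this that] obtain A' B' where "open A'" "open B'" "x \<in> A'" "y \<in> B'" "hol2 F A' B'" by blast
    then have "(\<lambda>x. F x y) field_differentiable at x"
      using hol2_fst holomorphic_on_imp_differentiable_at by blast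
    then show "(\<lambda>x. F x y) field_differentiable at x within A"
      by (rule field_differentiable_at_within)
  qed
qed

text \<open>Cauchy's formula expresses the derivative in \<open>y\<close> through values of
  \<open>F\<close> on a circle, so the dependence on \<open>x\<close> is inherited from
  \<open>F\<close> under the integral sign.\<close>

lemma hol2_deriv_snd:
  assumes F: "hol2 F A B" and "open A" "open B"
  shows "hol2 (\<lambda>x. deriv (F x)) A B"
proof (rule hol2_local[OF assms(2,3)])
  fix x y assume "x \<in> A" "y \<in> B"
  obtain r where r: "r > 0" "cball y r \<subseteq> B"
    using \<open>open B\<close> \<open>y \<in> B\<close> open_contains_cball by blast
  have ne: "w \<noteq> v" if "v \<in> ball y r" "w \<in> sphere y r" for v w
    using that by auto
  have "hol2 (\<lambda>x v. contour_integral (circlepath y r) (\<lambda>w. F x w / (w - v)\<^sup>2)) A (ball y r)"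
  proof (rule hol2_circle_integral)
    show "continuous_on ((A \<times> ball y r) \<times> sphere y r)
       (\<lambda>p. F (fst (fst p)) (snd p) / (snd p - snd (fst p))\<^sup>2)"
      by (intro continuous_intros hol2_continuous_compose[OF F]) (use r ne in force)+
    show "(\<lambda>x. F x w / (w - v)\<^sup>2) holomorphic_on A" if "v \<in> ball y r" "w \<in> sphere y r" for v w
      using r by (intro holomorphic_intros hol2_fst[OF F]) (use r ne[OF that] that in auto)
    show "(\<lambda>v. F x w / (w - v)\<^sup>2) holomorphic_on ball y r" if "x \<in> A" "w \<in> sphere y r" for x w
      by (intro holomorphic_intros) (use ne that in auto)
  qed (use assms r in auto)
  then have *: "hol2 (\<lambda>x v. contour_integral (circlepath y r) (\<lambda>w. F x w / (w - v)\<^sup>2) * (1 / (2 * pi * \<i>)))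
     A (ball y r)"
    unfolding hol2_def by (intro conjI ballI continuous_intros holomorphic_intros) auto
  have "hol2 (\<lambda>x. deriv (F x)) A (ball y r)"
  proof (rule hol2_cong[OF *])
    fix x v assume "x \<in> A" "v \<in> ball y r"
    moreover have "F x holomorphic_on cball y r"
      using hol2_snd[OF F \<open>x \<in> A\<close>] r(2) holomorphic_on_subset by blast
    ultimately have "contour_integral (circlepath y r) (\<lambda>w. F x w / (w - v)\<^sup>2) = (2 * pi * \<i>) * deriv (F x) v"
      by (intro Cauchy_contour_integral_circlepath_2 holomorphic_on_imp_continuous_on)
         (auto intro: holomorphic_on_subset)
    then show "contour_integral (circlepath y r) (\<lambda>w. F x w / (w - v)\<^sup>2) * (1 / (2 * pi * \<i>)) = deriv (F x) v"
      by simp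
  qed
  then show "\<exists>A' B'. open A' \<and> open B' \<and> x \<in> A' \<and> y \<in> B' \<and> hol2 (\<lambda>x. deriv (F x)) A' B'"
    using \<open>open A\<close> \<open>x \<in> A\<close> r(1) by (intro exI[of _ A] exI[of _ "ball y r"]) auto
qed

text \<open>In F(x, \<psi>(x,z)) the variable \<open>x\<close> enters twice. Writing the value as
  the Cauchy integral of F(x,w) / (w - \<psi>(x,z)) separates the two: for fixed \<open>w\<close>
  both numerator and denominator are holomorphic in \<open>x\<close>, with no chain rule in two
  variables.\<close>

lemma hol2_compose_snd:
  assumes F: "hol2 F A B" and "open A" "open B" "open C" and \<psi>: "hol2 \<psi> A C"
    and im: "\<And>x z. x \<in> A \<Longrightarrow> z \<in> C \<Longrightarrow> \<psi> x z \<in> B"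
  shows "hol2 (\<lambda>x z. F x (\<psi> x z)) A C"
proof (rule hol2_local[OF \<open>open A\<close> \<open>open C\<close>])
  fix x0 z0 assume 0: "x0 \<in> A" "z0 \<in> C"
  define y0 where "y0 = \<psi> x0 z0"
  obtain r where r: "r > 0" "cball y0 r \<subseteq> B"
    using \<open>open B\<close> im[OF 0] open_contains_cball unfolding y0_def by blast
  have "open (A \<times> C)" using assms by (simp add: open_Times)
  \<comment> \<open>Continuity of \<open>\<psi>\<close> gives a product neighbourhood on which its
    values stay inside one disc, so a single circle serves all parameters.\<close>
  have "open ((\<lambda>p. \<psi> (fst p) (snd p)) -` ball y0 r \<inter> (A \<times> C))"
    using continuous_open_preimage[OF hol2_continuous[OF \<psi>] \<open>open (A \<times> C)\<close>, of "ball y0 r"] by (simp add: Int_commute)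
  moreover have "(x0, z0) \<in> (\<lambda>p. \<psi> (fst p) (snd p)) -` ball y0 r \<inter> (A \<times> C)"
    using 0 r by (simp add: y0_def)
  ultimately obtain A' C' where A': "open A'" "open C'" "x0 \<in> A'" "z0 \<in> C'"
    "A' \<times> C' \<subseteq> (\<lambda>p. \<psi> (fst p) (snd p)) -` ball y0 r \<inter> (A \<times> C)"
    by (rule open_prod_elim) blast
  have sub: "A' \<subseteq> A" "C' \<subseteq> C" using A' by blast+
  have inb: "\<psi> x z \<in> ball y0 r" if "x \<in> A'" "z \<in> C'" for x z
    using A'(5) that by auto
  have \<psi>': "hol2 \<psi> A' C'" using hol2_subset[OF \<psi>] sub by blast
  have ne: "w \<noteq> \<psi> x z" if "x \<in> A'" "z \<in> C'" "w \<in> sphere y0 r" for x z w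
    using that inb[of x z] by auto
  have "hol2 (\<lambda>x z. contour_integral (circlepath y0 r) (\<lambda>w. F x w / (w - \<psi> x z))) A' C'"
  proof (rule hol2_circle_integral)
    show "continuous_on ((A' \<times> C') \<times> sphere y0 r)
       (\<lambda>p. F (fst (fst p)) (snd p) / (snd p - \<psi> (fst (fst p)) (snd (fst p))))"
      by (intro continuous_intros hol2_continuous_compose[OF F] hol2_continuous_compose[OF \<psi>'])
         (use r sub ne in force)+
    show "(\<lambda>x. F x w / (w - \<psi> x z)) holomorphic_on A'" if "z \<in> C'" "w \<in> sphere y0 r" for z w
      using r that sub ne
      by (intro holomorphic_intros holomorphic_on_subset[OF hol2_fst[OF F]] hol2_fst[OF \<psi>']) auto
    show "(\<lambda>z. F x w / (w - \<psi> x z)) holomorphic_on C'" if "x \<in> A'" "w \<in> sphere y0 r" for x w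
      using r that sub ne
      by (intro holomorphic_intros hol2_snd[OF \<psi>']) auto
  qed (use A' r in auto)
  then have *: "hol2 (\<lambda>x z. contour_integral (circlepath y0 r) (\<lambda>w. F x w / (w - \<psi> x z)) * (1 / (2 * pi * \<i>))) A' C'"
    unfolding hol2_def by (intro conjI ballI continuous_intros holomorphic_intros) auto
  have "hol2 (\<lambda>x z. F x (\<psi> x z)) A' C'"
  proof (rule hol2_cong[OF *])
    fix x z assume xz: "x \<in> A'" "z \<in> C'"
    have "F x holomorphic_on cball y0 r"
      using hol2_snd[OF F, of x] xz sub r(2) holomorphic_on_subset by blast
    from Cauchy_integral_circlepath_simple[OF this, of "\<psi> x z"] inb[OF xz]
    have "contour_integral (circlepath y0 r) (\<lambda>w. F x w / (w - \<psi> x z)) = 2 * pi * \<i> * F x (\<psi> x z)"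
      by (intro contour_integral_unique) (simp add: dist_norm norm_minus_commute)
    then show "contour_integral (circlepath y0 r) (\<lambda>w. F x w / (w - \<psi> x z)) * (1 / (2 * pi * \<i>)) = F x (\<psi> x z)"
      by simp
  qed
  then show "\<exists>A' B'. open A' \<and> open B' \<and> x0 \<in> A' \<and> z0 \<in> B' \<and> hol2 (\<lambda>x z. F x (\<psi> x z)) A' B'"
    using A' by blast
qed

text \<open>Nothing is assumed about how \<open>q\<close> depends on \<open>z\<close>. On a circle
  |w| = s the factor w^n is nonzero, so there \<open>q\<close> is the quotient G / w^n, regular in
  \<open>z\<close>; Cauchy's formula in \<open>x\<close> carries this to the interior, including x =
  0.\<close>

lemma hol2_divide_fst_power:
  assumes G: "hol2 G (ball 0 r) B" and "open B"
    and q: "\<And>z. z \<in> B \<Longrightarrow> (\<lambda>x. q x z) holomorphic_on ball 0 r"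
    and eq: "\<And>x z. x \<in> ball (0::complex) r \<Longrightarrow> z \<in> B \<Longrightarrow> G x z = x ^ n * q x z"
  shows "hol2 q (ball 0 r) B"
proof (rule hol2_local)
  fix x0 z0 :: complex assume 0: "x0 \<in> ball 0 r" "z0 \<in> B"
  obtain s where s: "norm x0 < s" "s < r" using 0 dense by auto
  have s0: "s > 0" using s(1) by (rule le_less_trans[OF norm_ge_zero])
  have ne: "w \<noteq> 0" "w \<noteq> x" if "x \<in> ball 0 s" "w \<in> sphere 0 s" for x w :: complex
    using that s0 by auto
  have "hol2 (\<lambda>x z. contour_integral (circlepath 0 s) (\<lambda>w. G w z / w ^ n / (w - x))) (ball 0 s) B"
  proof (rule hol2_circle_integral)
    show "continuous_on ((ball 0 s \<times> B) \<times> sphere 0 s)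
       (\<lambda>p. G (snd p) (snd (fst p)) / (snd p) ^ n / (snd p - fst (fst p)))"
      by (intro continuous_intros hol2_continuous_compose[OF G]) (use s ne in force)+
    show "(\<lambda>x. G w z / w ^ n / (w - x)) holomorphic_on ball 0 s" if "z \<in> B" "w \<in> sphere 0 s" for z w
      by (intro holomorphic_intros) (use ne that in auto)
    show "(\<lambda>z. G w z / w ^ n / (w - x)) holomorphic_on B" if "x \<in> ball 0 s" "w \<in> sphere 0 s" for x w
      by (intro holomorphic_intros hol2_snd[OF G]) (use s ne that in auto)
  qed (use assms s0 in auto)
  then have *: "hol2 (\<lambda>x z. contour_integral (circlepath 0 s) (\<lambda>w. G w z / w ^ n / (w - x)) * (1 / (2 * pi * \<i>)))
     (ball 0 s) B"
    unfolding hol2_def by (intro conjI ballI continuous_intros holomorphic_intros) auto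
  have "hol2 q (ball 0 s) B"
  proof (rule hol2_cong[OF *])
    fix x z :: complex assume xz: "x \<in> ball 0 s" "z \<in> B"
    have "(\<lambda>x. q x z) holomorphic_on cball 0 s"
      using q[OF xz(2)] s by (auto intro: holomorphic_on_subset)
    from Cauchy_integral_circlepath_simple[OF this, of x] xz
    have "((\<lambda>w. q w z / (w - x)) has_contour_integral 2 * pi * \<i> * q x z) (circlepath 0 s)"
      by simp
    then have "((\<lambda>w. G w z / w ^ n / (w - x)) has_contour_integral 2 * pi * \<i> * q x z) (circlepath 0 s)"
      by (rule has_contour_integral_eq) (use eq xz s s0 ne in auto)
    then show "contour_integral (circlepath 0 s) (\<lambda>w. G w z / w ^ n / (w - x)) * (1 / (2 * pi * \<i>)) = q x z"
      by (simp add: contour_integral_unique)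
  qed
  then show "\<exists>A' B'. open A' \<and> open B' \<and> x0 \<in> A' \<and> z0 \<in> B' \<and> hol2 q A' B'"
    using s 0 \<open>open B\<close> by (intro exI[of _ "ball 0 s"] exI[of _ B]) auto
qed (use assms in auto)

section \<open>Holomorphic functions of one variable\<close>

lemma holomorphic_on_ball_isCont_0:
  assumes "f holomorphic_on ball 0 r" "r > 0"
  shows "isCont f 0"
  using assms
  by (metis centre_in_ball continuous_on_eq_continuous_at holomorphic_on_imp_continuous_on open_ball)

section \<open>Factoring out zeros, and the argument principle\<close>

lemma holomorphic_factor_power:
  assumes f: "f holomorphic_on S" and S: "open S" "connected S" "z \<in> S"
    and ne: "\<exists>y\<in>S. f y \<noteq> 0"
  obtains n g where "g holomorphic_on S" "g z \<noteq> 0" "\<And>y. y \<in> S \<Longrightarrow> f y = (y - z) ^ n * g y"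
proof (cases "f z = 0")
  case False
  then show ?thesis using that[of f 0] f by simp
next
  case True
  then have "\<not> f constant_on S"
    using ne S(3) by (metis constant_on_def)
  then obtain g r n where g: "0 < n" "0 < r" "ball z r \<subseteq> S" "g holomorphic_on ball z r"
    "\<And>w. w \<in> ball z r \<Longrightarrow> f w = (w - z) ^ n * g w" "\<And>w. w \<in> ball z r \<Longrightarrow> g w \<noteq> 0"
    by (rule holomorphic_factor_zero_nonconstant[OF f S True]) (rule that)
  \<comment> \<open>The local cofactor is available only near \<open>z\<close>; elsewhere in
    \<open>S\<close> the quotient is already holomorphic, and the two agree on the overlap.\<close>
  define G where "G y = (if y = z then g z else f y / (y - z) ^ n)" for y
  have "(\<lambda>y. f y / (y - z) ^ n) holomorphic_on S - {z}"
    by (intro holomorphic_intros holomorphic_on_subset[OF f]) auto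
  then have "G holomorphic_on S - {z}"
    by (rule holomorphic_transform) (auto simp: G_def)
  moreover have "G holomorphic_on ball z r"
    by (rule holomorphic_transform[OF g(4)]) (use g in \<open>auto simp: G_def\<close>)
  ultimately have "G holomorphic_on (S - {z}) \<union> ball z r"
    using S by (intro holomorphic_on_Un) auto
  moreover have "S - {z} \<union> ball z r = S" using g S by auto
  ultimately have "G holomorphic_on S" by simp
  moreover have "G z \<noteq> 0" using g by (simp add: G_def)
  moreover have "f y = (y - z) ^ n * G y" if "y \<in> S" for y
    using True g by (auto simp: G_def)
  ultimately show ?thesis by (rule that)
qed

text \<open>The zeros are removed point by point, each with its full order. Roots form a list so
  that multiplicities are kept; a point of \<open>Z\<close> that is not a zero contributes no
  entry.\<close>

lemma holomorphic_factor_finite: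
  assumes f: "f holomorphic_on S" and S: "open S" "connected S" and ne: "\<exists>y\<in>S. f y \<noteq> 0"
    and "finite Z" "Z \<subseteq> S"
  shows "\<exists>ys h. set ys \<subseteq> Z \<and> h holomorphic_on S \<and> (\<forall>z\<in>Z. h z \<noteq> 0) \<and>
           (\<forall>y\<in>S. f y = (\<Prod>a\<leftarrow>ys. y - a) * h y)"
  using \<open>finite Z\<close> \<open>Z \<subseteq> S\<close>
proof (induction Z)
  case empty
  then show ?case using f by (intro exI[of _ "[]"] exI[of _ f]) auto
next
  case (insert z Z)
  then obtain ys h where h: "set ys \<subseteq> Z" "h holomorphic_on S" "\<forall>z\<in>Z. h z \<noteq> 0"
    "\<forall>y\<in>S. f y = (\<Prod>a\<leftarrow>ys. y - a) * h y"
    by auto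
  have "z \<in> S" "\<exists>y\<in>S. h y \<noteq> 0"
    using insert.prems ne h by auto
  then obtain n g where g: "g holomorphic_on S" "g z \<noteq> 0" "\<And>y. y \<in> S \<Longrightarrow> h y = (y - z) ^ n * g y"
    using holomorphic_factor_power[OF h(2) S] by metis
  have "\<forall>w\<in>insert z Z. g w \<noteq> 0"
    using g h insert.prems by (metis insert_iff mult_zero_right subsetD)
  moreover have "f y = (\<Prod>a\<leftarrow>replicate n z @ ys. y - a) * g y" if "y \<in> S" for y
    using h(4) g(3)[OF that] that by simp
  moreover have "set (replicate n z @ ys) \<subseteq> insert z Z"
    using h(1) by auto
  ultimately show ?case using g(1) by blast
qed

text \<open>A zero-free boundary circle forces all zeros of the closed disc into the open one, and
  compactness makes them finite in number.\<close>

lemma holomorphic_factor_cball: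
  assumes f: "f holomorphic_on ball 0 r" and e: "0 < e" "e < r"
    and ne: "\<And>y. norm y = e \<Longrightarrow> f y \<noteq> 0"
  obtains ys h where "set ys \<subseteq> ball 0 e" "h holomorphic_on ball 0 r" "\<And>y. y \<in> cball 0 e \<Longrightarrow> h y \<noteq> 0"
    "\<And>y. y \<in> ball 0 r \<Longrightarrow> f y = (\<Prod>a\<leftarrow>ys. y - a) * h y"
proof -
  have ne': "\<exists>y\<in>ball 0 r. f y \<noteq> 0"
    using e ne[of "of_real e"] by (intro bexI[of _ "of_real e"]) auto
  define Z where "Z = {y \<in> cball 0 e. f y = 0}"
  have Z: "Z \<subseteq> ball 0 e" using ne by (force simp: Z_def less_le)
  have "finite Z"
  proof (cases "f constant_on ball 0 r")
    case True
    then have "Z = {}" using ne' e by (auto simp: Z_def constant_on_def)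
    then show ?thesis by simp
  next
    case False
    then show ?thesis unfolding Z_def
      using e by (intro holomorphic_compact_finite_zeros[OF f]) auto
  qed
  have "Z \<subseteq> ball 0 r" using Z e by auto
  from holomorphic_factor_finite[OF f open_ball connected_ball ne' \<open>finite Z\<close> this]
  obtain ys h where h: "set ys \<subseteq> Z" "h holomorphic_on ball 0 r" "\<forall>z\<in>Z. h z \<noteq> 0"
    "\<forall>y\<in>ball 0 r. f y = (\<Prod>a\<leftarrow>ys. y - a) * h y"
    by blast
  have "h y \<noteq> 0" if "y \<in> cball 0 e" for y
  proof (cases "y \<in> Z")
    case False
    then have "f y \<noteq> 0" using that by (auto simp: Z_def)
    moreover have "y \<in> ball 0 r" using that e by auto
    ultimately show ?thesis using h(4) by auto
  qed (use h in auto)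
  then show ?thesis using that[of ys h] h Z by blast
qed

text \<open>The logarithmic derivative turns the product into a sum: each root \<open>b\<close>
  contributes y^j / (y - b), with integral 2 \<pi> i b^j by Cauchy's formula, and the zero-free
  cofactor contributes a holomorphic term with integral 0. The case j = 0 counts roots.\<close>

lemma contour_integral_log_deriv_prod:
  assumes h: "h holomorphic_on ball 0 r" and e: "0 < e" "e < r"
    and h0: "\<And>y. y \<in> cball 0 e \<Longrightarrow> h y \<noteq> 0"
    and ys: "set ys \<subseteq> ball 0 e"
    and f: "\<And>y. y \<in> ball 0 r \<Longrightarrow> f y = (\<Prod>a\<leftarrow>ys. y - a) * h y"
  shows "((\<lambda>y. y ^ j * deriv f y / f y) has_contour_integral (2 * pi * \<i> * (\<Sum>a\<leftarrow>ys. a ^ j))) (circlepath 0 e)"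
  using ys f
proof (induction ys arbitrary: f)
  case Nil
  have dh: "deriv h holomorphic_on ball 0 r"
    using h by (intro holomorphic_deriv) auto
  have "(\<lambda>y. y ^ j * deriv h y / h y) holomorphic_on cball 0 e"
    using e h0 by (intro holomorphic_intros holomorphic_on_subset[OF h] holomorphic_on_subset[OF dh]) auto
  then have 0: "((\<lambda>y. y ^ j * deriv h y / h y) has_contour_integral 0) (circlepath 0 e)"
    by (rule Cauchy_theorem_convex_simple) (use e in auto)
  have "deriv f y = deriv h y" if "y \<in> ball 0 r" for y
    by (intro deriv_cong_ev eventually_mono[OF eventually_nhds_in_open[OF open_ball that]])
       (use Nil in auto)
  then have "((\<lambda>y. y ^ j * deriv f y / f y) has_contour_integral 0) (circlepath 0 e)"
    by (intro has_contour_integral_eq[OF 0]) (use Nil e in auto)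
  then show ?case by simp
next
  case (Cons b ys)
  define f1 where "f1 y = (\<Prod>a\<leftarrow>ys. y - a) * h y" for y
  have "set ys \<subseteq> ball 0 e" and b: "norm b < e" using Cons.prems(1) by auto
  from Cons.IH[OF this(1) f1_def] have 1: "((\<lambda>y. y ^ j * deriv f1 y / f1 y) has_contour_integral
      2 * pi * \<i> * (\<Sum>a\<leftarrow>ys. a ^ j)) (circlepath 0 e)" .
  have "(\<lambda>y. y ^ j) holomorphic_on cball 0 e" by (intro holomorphic_intros)
  from Cauchy_integral_circlepath_simple[OF this, of b] b
  have 2: "((\<lambda>y. y ^ j / (y - b)) has_contour_integral 2 * pi * \<i> * b ^ j) (circlepath 0 e)"
    by simp
  have prod_hol: "(\<lambda>y. \<Prod>a\<leftarrow>ys. y - a) holomorphic_on A" for A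
    by (induction ys) (auto intro!: holomorphic_intros)
  have f1: "f1 holomorphic_on ball 0 r"
    unfolding f1_def by (intro holomorphic_intros prod_hol h)
  have nz: "(\<Prod>a\<leftarrow>ys. y - a) \<noteq> 0" if "norm y = e" for y
    using that Cons.prems(1) by (auto simp: prod_list_zero_iff)
  have "y ^ j * deriv f1 y / f1 y + y ^ j / (y - b) = y ^ j * deriv f y / f y"
    if y: "y \<in> path_image (circlepath 0 e)" for y
  proof -
    have ny: "norm y = e" using y e by simp
    then have yr: "y \<in> ball 0 r" using e by simp
    have d1: "(f1 has_field_derivative deriv f1 y) (at y)"
      using f1 yr holomorphic_derivI open_ball by blast
    have "deriv f y = deriv (\<lambda>y. (y - b) * f1 y) y"
      by (intro deriv_cong_ev eventually_mono[OF eventually_nhds_in_open[OF open_ball yr]])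
         (use Cons.prems(2) in \<open>auto simp: f1_def\<close>)
    also have "\<dots> = f1 y + (y - b) * deriv f1 y"
      by (rule DERIV_imp_deriv) (auto intro!: derivative_eq_intros d1)
    finally have df: "deriv f y = f1 y + (y - b) * deriv f1 y" .
    have fy: "f y = (y - b) * f1 y"
      using Cons.prems(2)[OF yr] by (simp add: f1_def)
    have "y - b \<noteq> 0" using ny b by auto
    moreover have "f1 y \<noteq> 0" unfolding f1_def using nz[OF ny] h0[of y] ny by simp
    ultimately show ?thesis
      unfolding df fy by (simp add: divide_simps) (simp add: algebra_simps)
  qed
  from has_contour_integral_eq[OF has_contour_integral_add[OF 1 2] this]
  show ?case by (simp add: algebra_simps)
qed

section \<open>Information carried by the real axis\<close>

lemma positive_null_sequence:
  assumes "r > (0::real)"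
  obtains t :: "nat \<Rightarrow> real" where "\<And>n. 0 < t n" "\<And>n. t n < r" "t \<longlonglongrightarrow> 0"
    "(\<lambda>n. complex_of_real (t n)) \<longlonglongrightarrow> 0"
proof -
  define t where "t n = r / 2 * inverse (real (Suc n))" for n
  have "t n \<le> r / 2" for n
    using assms by (simp add: t_def field_simps)
  then have "t n < r" for n
    using assms by (smt (verit) field_sum_of_halves)
  moreover have "t \<longlonglongrightarrow> 0"
    unfolding t_def using LIMSEQ_inverse_real_of_nat tendsto_mult_right_zero by blast
  moreover from tendsto_of_real[OF this] have "(\<lambda>n. complex_of_real (t n)) \<longlonglongrightarrow> 0" by simp
  ultimately show ?thesis using that[of t] assms by (simp add: t_def)
qed

lemma holomorphic_zero_on_reals:
  assumes g: "g holomorphic_on ball 0 r" and "r > 0"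
    and z: "\<And>x::real. \<bar>x\<bar> < r \<Longrightarrow> g (of_real x) = 0" and x: "x \<in> ball 0 r"
  shows "g x = 0"
proof (rule analytic_continuation[OF g open_ball connected_ball])
  let ?U = "{complex_of_real t | t. \<bar>t\<bar> < r}"
  show "?U \<subseteq> ball 0 r" by auto
  obtain t where t: "\<And>n. 0 < t n" "\<And>n. t n < r" "(\<lambda>n. complex_of_real (t n)) \<longlonglongrightarrow> 0"
    by (rule positive_null_sequence[OF \<open>r > 0\<close>]) (rule that)
  have "complex_of_real (t n) \<in> ?U - {0}" for n
    using t(1,2)[of n] by (auto intro!: exI[of _ "t n"])
  then show "0 islimpt ?U"
    unfolding islimpt_sequential using t(3) by (intro exI[of _ "\<lambda>n. complex_of_real (t n)"]) simp
qed (use assms in auto)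

text \<open>If the order \<open>m\<close> of \<open>g\<close> at 0 were below \<open>n\<close>,
  cancelling x^m would bound the nonvanishing cofactor by C |x|^(n-m), which tends to 0 along the
  real axis. A bound on real points therefore suffices.\<close>

lemma holomorphic_divide_power:
  assumes g: "g holomorphic_on ball 0 r" and "r > 0"
    and bd: "\<And>x::real. \<bar>x\<bar> < r \<Longrightarrow> norm (g (of_real x)) \<le> C * \<bar>x\<bar> ^ n"
  obtains q where "q holomorphic_on ball 0 r" "\<And>x. x \<in> ball 0 r \<Longrightarrow> g x = x ^ n * q x"
proof (cases "\<exists>y\<in>ball 0 r. g y \<noteq> 0")
  case False
  then show ?thesis using that[of "\<lambda>_. 0"] by auto
next
  case True
  then obtain m w where w: "w holomorphic_on ball 0 r" "w 0 \<noteq> 0"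
    "\<And>y. y \<in> ball 0 r \<Longrightarrow> g y = (y - 0) ^ m * w y"
    using holomorphic_factor_power[OF g open_ball connected_ball, of 0] \<open>r > 0\<close>
    by (metis centre_in_ball)
  have "n \<le> m"
  proof (rule ccontr)
    assume "\<not> n \<le> m"
    then have nm: "n - m > 0" by simp
    obtain t where t: "\<And>k. 0 < t k" "\<And>k. t k < r" and t0: "t \<longlonglongrightarrow> 0"
      and tc: "(\<lambda>n. complex_of_real (t n)) \<longlonglongrightarrow> 0"
      by (rule positive_null_sequence[OF \<open>r > 0\<close>]) (rule that)
    have "isCont w 0"
      by (rule holomorphic_on_ball_isCont_0[OF w(1) \<open>r > 0\<close>])
    then have 1: "(\<lambda>k. w (of_real (t k))) \<longlonglongrightarrow> w 0"
      by (rule isCont_tendsto_compose[OF _ tc])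
    have "norm (w (of_real (t k))) \<le> C * t k ^ (n - m)" for k
    proof -
      have "t k ^ m * norm (w (of_real (t k))) = norm (g (of_real (t k)))"
        using w(3)[of "of_real (t k)"] t[of k] by (simp add: norm_mult norm_power)
      also have "\<dots> \<le> C * t k ^ n" using bd[of "t k"] t[of k] by simp
      also have "\<dots> = t k ^ m * (C * t k ^ (n - m))"
        using \<open>\<not> n \<le> m\<close> by (simp add: power_add[symmetric])
      finally show ?thesis using t[of k] by simp
    qed
    moreover have "(\<lambda>k. C * t k ^ (n - m)) \<longlonglongrightarrow> C * 0 ^ (n - m)"
      by (intro tendsto_intros t0)
    ultimately have "norm (w 0) \<le> C * 0 ^ (n - m)"
      using tendsto_norm[OF 1] by (intro LIMSEQ_le[of "\<lambda>k. norm (w (of_real (t k)))"]) auto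
    then show False using w(2) nm by (simp add: power_0_left)
  qed
  then have "g x = x ^ n * (x ^ (m - n) * w x)" if "x \<in> ball 0 r" for x
    using w(3)[OF that] by (simp add: power_add[symmetric] flip: mult.assoc)
  moreover have "(\<lambda>x. x ^ (m - n) * w x) holomorphic_on ball 0 r"
    by (intro holomorphic_intros w)
  ultimately show ?thesis using that by blast
qed

text \<open>The derivative can be computed with real increments, and a limit of real difference
  quotients is real because the real line is closed.\<close>

lemma deriv_real_on_reals:
  assumes f: "f holomorphic_on ball 0 r"
    and re: "\<And>x::real. \<bar>x\<bar> < r \<Longrightarrow> f (of_real x) \<in> \<real>" and x: "\<bar>x\<bar> < r"
  shows "deriv f (of_real x) \<in> \<real>"
proof -
  have "(f has_field_derivative deriv f (of_real x)) (at (of_real x))"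
    using f x by (intro holomorphic_derivI[OF _ open_ball]) auto
  then have lim: "((\<lambda>h. (f (of_real x + h) - f (of_real x)) / h) \<longlongrightarrow> deriv f (of_real x)) (at 0)"
    by (simp add: DERIV_def)
  define d where "d = r - \<bar>x\<bar>"
  have "d > 0" using x by (simp add: d_def)
  obtain t where t: "\<And>n. 0 < t n" "\<And>n. t n < d" "(\<lambda>n. complex_of_real (t n)) \<longlonglongrightarrow> 0"
    by (rule positive_null_sequence[OF \<open>d > 0\<close>]) (rule that)
  have "filterlim (\<lambda>n. complex_of_real (t n)) (at 0) sequentially"
    unfolding filterlim_at using t(1,3) by (simp add: order.strict_implies_not_eq[symmetric])
  from filterlim_compose[OF lim this]
  have l: "(\<lambda>n. (f (of_real x + of_real (t n)) - f (of_real x)) / of_real (t n)) \<longlonglongrightarrow> deriv f (of_real x)" .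
  have "(f (of_real x + of_real (t n)) - f (of_real x)) / of_real (t n) \<in> \<real>" for n
  proof -
    have "\<bar>x + t n\<bar> < r" using t(1,2)[of n] by (simp add: d_def)
    from re[OF this] re[OF x] show ?thesis by (simp add: Reals_divide Reals_diff)
  qed
  then show ?thesis
    by (intro Lim_in_closed_set[OF closed_complex_Reals _ _ l]) auto
qed

lemma higher_deriv_real_on_reals:
  assumes f: "f holomorphic_on ball 0 r"
    and re: "\<And>x::real. \<bar>x\<bar> < r \<Longrightarrow> f (of_real x) \<in> \<real>" and x: "\<bar>x\<bar> < r"
  shows "(deriv ^^ n) f (of_real x) \<in> \<real>"
  using x
proof (induction n arbitrary: x)
  case (Suc n)
  then show ?case
    using deriv_real_on_reals[of "(deriv ^^ n) f" r x] holomorphic_higher_deriv[OF f open_ball] by simp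
qed (use re in auto)

lemma holomorphic_imp_ps1:
  assumes f: "f holomorphic_on ball 0 r" and "r > 0"
    and re: "\<And>x::real. \<bar>x\<bar> < r \<Longrightarrow> f (of_real x) \<in> \<real>"
  obtains c where "conv1 c" "complex_of_real (c 0) = f 0" "\<And>x. x \<in> ball 0 r \<Longrightarrow> ps1 c x = f x"
proof -
  define c where "c n = Re ((deriv ^^ n) f 0 / fact n)" for n
  have c: "complex_of_real (c n) = (deriv ^^ n) f 0 / fact n" for n
  proof -
    have "(deriv ^^ n) f (of_real 0) \<in> \<real>"
      by (rule higher_deriv_real_on_reals[OF f re]) (use \<open>r > 0\<close> in auto)
    then have "(deriv ^^ n) f 0 / of_real (fact n) \<in> \<real>" by (intro Reals_divide Reals_of_real) simp
    then show ?thesis unfolding c_def by (simp add: complex_is_Real_iff complex_eq_iff)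
  qed
  have s: "(\<lambda>n. of_real (c n) * x ^ n) sums f x" if "x \<in> ball 0 r" for x
    using holomorphic_power_series[OF f that] by (simp add: c)
  \<comment> \<open>Convergence at radius r/2 gives absolute convergence only at strictly smaller
    radii, hence r/3 in the next step.\<close>
  have "summable (\<lambda>n. of_real (c n) * (of_real (r/2) :: complex) ^ n)"
    using s[of "of_real (r/2)"] \<open>r > 0\<close> by (auto simp: sums_iff)
  then have "summable (\<lambda>n. norm (of_real (c n) * (of_real (r/3) :: complex) ^ n))"
    by (rule powser_insidea) (use \<open>r > 0\<close> in auto)
  then have "summable (\<lambda>n. \<bar>c n\<bar> * (r/3) ^ n)"
    using \<open>r > 0\<close> by (simp add: norm_mult norm_power del: of_real_divide)
  then have "conv1 c" unfolding conv1_def using \<open>r > 0\<close> by (intro exI[of _ "r/3"]) auto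
  moreover have "ps1 c x = f x" if "x \<in> ball 0 r" for x
    using s[OF that] by (simp add: ps1_def sums_iff)
  ultimately show ?thesis using that[of c] c[of 0] by simp
qed

text \<open>Bolzano-Weierstrass applied to one coordinate after another; passing to a further
  subsequence keeps the limits already obtained.\<close>

lemma bounded_sequences_common_subsequence:
  fixes z :: "nat \<Rightarrow> nat \<Rightarrow> complex"
  assumes "\<And>i n. i < M \<Longrightarrow> norm (z i n) \<le> C"
  shows "\<exists>s l. strict_mono s \<and> (\<forall>i<M. (\<lambda>n. z i (s n)) \<longlonglongrightarrow> l i)"
  using assms
proof (induction M)
  case 0
  then show ?case using strict_mono_id by auto
next
  case (Suc M)
  then obtain s l where s: "strict_mono s" "\<forall>i<M. (\<lambda>n. z i (s n)) \<longlonglongrightarrow> l i"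
    by (metis less_Suc_eq)
  have "\<forall>n. z M (s n) \<in> cball 0 C" using Suc.prems by simp
  then obtain l' t where t: "strict_mono t" "((\<lambda>n. z M (s n)) \<circ> t) \<longlonglongrightarrow> l'"
    using compact_cball[of "0::complex" C] unfolding compact_def by metis
  have "(\<lambda>n. z i ((s \<circ> t) n)) \<longlonglongrightarrow> (l(M := l')) i" if "i < Suc M" for i
  proof (cases "i = M")
    case True
    then show ?thesis using t by (simp add: o_def)
  next
    case False
    then have "(\<lambda>n. z i (s n)) \<longlonglongrightarrow> l i" using s that by simp
    from LIMSEQ_subseq_LIMSEQ[OF this t(1)] show ?thesis using False by (simp add: o_def)
  qed
  moreover have "strict_mono (s \<circ> t)" using s t by (simp add: strict_mono_o)
  ultimately show ?case by blast
qed

section \<open>Convergent power series in two variables\<close>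

text \<open>The M-test with majorant |a i j| r^(i+j) makes the finite partial sums converge
  uniformly on the closed polydisc, and uniform limits of polynomials are continuous and separately
  holomorphic. Absolute summability is exported for the restriction to x = 0.\<close>

lemma conv2_imp_hol2:
  assumes "conv2 a"
  obtains r where "r > 0" "hol2 (ps2 a) (ball 0 r) (ball 0 r)"
    "\<And>x y. x \<in> ball 0 r \<Longrightarrow> y \<in> ball 0 r \<Longrightarrow>
       (\<lambda>(i,j). norm (a i j * x ^ i * y ^ j)) summable_on UNIV"
proof -
  obtain r where r: "r > 0" "(\<lambda>(i,j). norm (a i j) * r ^ (i + j)) summable_on UNIV"
    using assms by (auto simp: conv2_def)
  define f where "f = (\<lambda>(i, j) p. a i j * fst p ^ i * snd p ^ j)"
  have bd: "norm (f k p) \<le> (\<lambda>(i,j). norm (a i j) * r ^ (i + j)) k" if "p \<in> cball 0 r \<times> cball 0 r" for k p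
  proof -
    obtain i j where k: "k = (i, j)" by force
    have "norm (fst p) ^ i * norm (snd p) ^ j \<le> r ^ i * r ^ j"
      using that r by (intro mult_mono power_mono) auto
    then show ?thesis
      unfolding k f_def by (simp add: norm_mult norm_power power_add mult.assoc mult_left_mono)
  qed
  have ul: "uniform_limit (cball 0 r \<times> cball 0 r) (\<lambda>X p. \<Sum>k\<in>X. f k p) (\<lambda>p. \<Sum>\<^sub>\<infinity>k. f k p)
         (finite_subsets_at_top UNIV)"
    by (rule Weierstrass_m_test_general[OF bd r(2)])
  have eq: "(\<lambda>p. \<Sum>\<^sub>\<infinity>k. f k p) = (\<lambda>p. ps2 a (fst p) (snd p))"
    unfolding ps2_def f_def by (intro ext infsum_cong) auto
  note ul = ul[unfolded eq]
  have cont: "continuous_on S (\<lambda>p. \<Sum>k\<in>X. f k p)" for X S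
    unfolding f_def case_prod_beta by (intro continuous_intros)
  have c: "continuous_on (cball 0 r \<times> cball 0 r) (\<lambda>p. ps2 a (fst p) (snd p))"
    by (rule uniform_limit_theorem[OF _ ul]) (auto intro: cont)
  have h1: "ps2 a x holomorphic_on ball 0 r" if "x \<in> ball 0 r" for x
  proof (rule holomorphic_uniform_limit[where f = "\<lambda>X y. \<Sum>k\<in>X. f k (x, y)" and F = "finite_subsets_at_top UNIV"])
    show "uniform_limit (cball 0 r) (\<lambda>X y. \<Sum>k\<in>X. f k (x, y)) (ps2 a x) (finite_subsets_at_top UNIV)"
      using uniform_limit_compose'[OF ul, of "\<lambda>y. (x, y)" "cball 0 r"] that by (simp add: o_def)
    show "\<forall>\<^sub>F X in finite_subsets_at_top UNIV. continuous_on (cball 0 r) (\<lambda>y. \<Sum>k\<in>X. f k (x, y)) \<and>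
       (\<lambda>y. \<Sum>k\<in>X. f k (x, y)) holomorphic_on ball 0 r"
      unfolding f_def case_prod_beta fst_conv snd_conv
      by (intro always_eventually allI conjI continuous_intros holomorphic_intros)
  qed auto
  have h2: "(\<lambda>x. ps2 a x y) holomorphic_on ball 0 r" if "y \<in> ball 0 r" for y
  proof (rule holomorphic_uniform_limit[where f = "\<lambda>X x. \<Sum>k\<in>X. f k (x, y)" and F = "finite_subsets_at_top UNIV"])
    show "uniform_limit (cball 0 r) (\<lambda>X x. \<Sum>k\<in>X. f k (x, y)) (\<lambda>x. ps2 a x y) (finite_subsets_at_top UNIV)"
      using uniform_limit_compose'[OF ul, of "\<lambda>x. (x, y)" "cball 0 r"] that by (simp add: o_def)
    show "\<forall>\<^sub>F X in finite_subsets_at_top UNIV. continuous_on (cball 0 r) (\<lambda>x. \<Sum>k\<in>X. f k (x, y)) \<and>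
       (\<lambda>x. \<Sum>k\<in>X. f k (x, y)) holomorphic_on ball 0 r"
      unfolding f_def case_prod_beta fst_conv snd_conv
      by (intro always_eventually allI conjI continuous_intros holomorphic_intros)
  qed auto
  have "hol2 (ps2 a) (ball 0 r) (ball 0 r)"
    unfolding hol2_def using h1 h2 by (auto intro!: continuous_on_subset[OF c])
  moreover have "(\<lambda>(i,j). norm (a i j * x ^ i * y ^ j)) summable_on UNIV"
    if "x \<in> ball 0 r" "y \<in> ball 0 r" for x y
    by (rule summable_on_comparison_test[OF r(2)]) (use bd[of "(x, y)"] that in \<open>auto simp: f_def\<close>)
  ultimately show ?thesis using that r(1) by blast
qed

lemma ps2_0_factor:
  assumes a: "conv2 a" and nz: "\<exists>j. a 0 j \<noteq> 0"
  obtains r h where "r > 0" "h holomorphic_on ball 0 r" "h 0 \<noteq> 0"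
    "\<And>y. y \<in> ball 0 r \<Longrightarrow> ps2 a 0 y = y ^ ord_y0 a * h y"
proof -
  obtain r where r: "r > 0" and
    sm: "\<And>x y. x \<in> ball 0 r \<Longrightarrow> y \<in> ball 0 r \<Longrightarrow>
       (\<lambda>(i,j). norm (a i j * x ^ i * y ^ j)) summable_on UNIV"
    by (rule conv2_imp_hol2[OF a]) (rule that)
  let ?M = "ord_y0 a"
  have M1: "a 0 ?M \<noteq> 0" unfolding ord_y0_def by (rule LeastI_ex[OF nz])
  have M2: "a 0 j = 0" if "j < ?M" for j
    using not_less_Least[OF that[unfolded ord_y0_def]] by simp
  have s: "(\<lambda>j. a 0 j * y ^ j) sums ps2 a 0 y" if "y \<in> ball 0 r" for y
  proof -
    have "(\<lambda>(i,j). norm (a i j * 0 ^ i * y ^ j)) summable_on UNIV"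
      using sm[of 0 y] that r by simp
    then have "(\<lambda>k. norm ((\<lambda>(i,j). a i j * 0 ^ i * y ^ j) k)) summable_on UNIV"
      by (simp add: case_prod_unfold)
    then have "(\<lambda>(i,j). a i j * 0 ^ i * y ^ j) summable_on UNIV"
      by (rule abs_summable_summable)
    then have *: "((\<lambda>(i,j). a i j * 0 ^ i * y ^ j) has_sum ps2 a 0 y) UNIV"
      unfolding ps2_def by (rule has_sum_infsum)
    \<comment> \<open>With 0^0 = 1, exactly the terms of index i = 0 survive, so the double sum
      collapses to a series in \<open>y\<close>.\<close>
    have "((\<lambda>(i,j). a i j * 0 ^ i * y ^ j) has_sum ps2 a 0 y) (Pair 0 ` UNIV)"
      by (rule has_sum_cong_neutral[THEN iffD1, OF _ _ _ *]) (auto simp: power_0_left image_iff)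
    then have "((\<lambda>j. a 0 j * y ^ j) has_sum ps2 a 0 y) UNIV"
      by (subst (asm) has_sum_reindex) (auto simp: inj_on_def o_def)
    then show ?thesis by (rule has_sum_imp_sums)
  qed
  define h where "h y = (\<Sum>j. a 0 (j + ?M) * y ^ j)" for y
  have sM: "summable (\<lambda>j. a 0 (j + ?M) * y ^ j)" and eq: "ps2 a 0 y = y ^ ?M * h y"
    if y: "y \<in> ball 0 r" for y
  proof -
    have "(\<lambda>j. a 0 (j + ?M) * y ^ (j + ?M)) sums (ps2 a 0 y - (\<Sum>j<?M. a 0 j * y ^ j))"
      using s[OF y] by (rule sums_split_initial_segment)
    then have 1: "(\<lambda>j. y ^ ?M * (a 0 (j + ?M) * y ^ j)) sums ps2 a 0 y"
      using M2 by (simp add: power_add mult_ac)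
    show sm: "summable (\<lambda>j. a 0 (j + ?M) * y ^ j)"
    \<comment> \<open>Summability is obtained by cancelling y^M, which is impossible at y = 0, where
      the series has just one nonzero term at most.\<close>
    proof (cases "y = 0")
      case True
      then show ?thesis
        using summable_zero_power'[of "\<lambda>j. a 0 (j + ?M)"] by simp
    next
      case False
      then show ?thesis using 1 by (auto dest!: sums_summable)
    qed
    from sums_mult[OF summable_sums[OF sm], of "y ^ ?M"] 1
    show "ps2 a 0 y = y ^ ?M * h y" unfolding h_def by (metis sums_unique2)
  qed
  have "(\<lambda>j. a 0 (j + ?M) * (w - 0) ^ j) sums h w" if "w \<in> ball 0 r" for w
    using summable_sums[OF sM[OF that]] by (simp add: h_def)
  then have "h holomorphic_on ball 0 r"
    by (rule power_series_holomorphic)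
  moreover have "h 0 \<noteq> 0" unfolding h_def using M1 by simp
  ultimately show ?thesis using that r eq by blast
qed

section \<open>From holomorphic functions back to coefficients\<close>

lemma hol2_higher_deriv_snd:
  assumes F: "hol2 F A B" and "open A" "open B"
  shows "hol2 (\<lambda>x. (deriv ^^ n) (F x)) A B"
proof (induction n)
  case (Suc n)
  from hol2_deriv_snd[OF this assms(2,3)] show ?case by simp
qed (use F in simp)

text \<open>Two successive Taylor expansions: \<open>g i\<close> is the coefficient of x^i as a
  function of \<open>y\<close>, and \<open>b i j\<close> is the coefficient of y^j in
  \<open>g i\<close>. Cauchy's inequality applied twice bounds \<open>b i j\<close> geometrically,
  which makes the iterated sum an unconditional double sum.\<close>

lemma hol2_imp_ps2:
  assumes F: "hol2 F (ball 0 r) (ball 0 r)" and "r > 0"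
  obtains b s where "conv2 b" "s > 0" "\<And>x y. x \<in> ball 0 s \<Longrightarrow> y \<in> ball 0 s \<Longrightarrow> ps2 b x y = F x y"
proof -
  define g where "g i y = (deriv ^^ i) (\<lambda>x. F x y) 0 / fact i" for i y
  define b where "b i j = (deriv ^^ j) (g i) 0 / fact j" for i j
  define \<rho> where "\<rho> = r / 2"
  have \<rho>: "0 < \<rho>" "\<rho> < r" using \<open>r > 0\<close> by (auto simp: \<rho>_def)
  have "compact ((\<lambda>p. F (fst p) (snd p)) ` (cball 0 \<rho> \<times> cball 0 \<rho>))"
    using \<rho> by (intro compact_continuous_image compact_Times continuous_on_subset[OF hol2_continuous[OF F]]) auto
  from compact_imp_bounded[OF this] obtain C
    where "\<forall>p \<in> cball 0 \<rho> \<times> cball 0 \<rho>. norm (F (fst p) (snd p)) \<le> C"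
    by (auto simp: bounded_iff)
  then have C: "norm (F x y) \<le> C" if "x \<in> cball 0 \<rho>" "y \<in> cball 0 \<rho>" for x y
    using that by fastforce
  have F': "hol2 (\<lambda>y x. F x y) (ball 0 r) (ball 0 r)" by (rule hol2_flip[OF F])
  have ghol: "g i holomorphic_on ball 0 r" for i
    unfolding g_def
    using hol2_fst[OF hol2_higher_deriv_snd[OF F', of i], of 0] \<open>r > 0\<close>
    by (intro holomorphic_intros) auto
  have gb: "norm (g i y) \<le> C / \<rho> ^ i" if "y \<in> cball 0 \<rho>" for i y
  proof -
    have h: "(\<lambda>x. F x y) holomorphic_on ball 0 r" using hol2_fst[OF F] that \<rho> by auto
    have "norm ((deriv ^^ i) (\<lambda>x. F x y) 0) \<le> fact i * C / \<rho> ^ i"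
    proof (rule Cauchy_inequality)
      show "(\<lambda>x. F x y) holomorphic_on ball 0 \<rho>" "continuous_on (cball 0 \<rho>) (\<lambda>x. F x y)"
        using h \<rho> by (auto intro!: holomorphic_on_imp_continuous_on elim!: holomorphic_on_subset)
    qed (use C that \<rho> in auto)
    then show ?thesis by (simp add: g_def norm_divide field_simps)
  qed
  have bb: "norm (b i j) \<le> C / \<rho> ^ i / \<rho> ^ j" for i j
  proof -
    have "norm ((deriv ^^ j) (g i) 0) \<le> fact j * (C / \<rho> ^ i) / \<rho> ^ j"
    proof (rule Cauchy_inequality)
      show "g i holomorphic_on ball 0 \<rho>" "continuous_on (cball 0 \<rho>) (g i)"
        using ghol[of i] \<rho> by (auto intro!: holomorphic_on_imp_continuous_on elim!: holomorphic_on_subset)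
    qed (use gb \<rho> in auto)
    then show ?thesis by (simp add: b_def norm_divide field_simps)
  qed
  \<comment> \<open>Half the radius of the Cauchy estimates, so that the terms are dominated by C /
    2^(i+j).\<close>
  define s where "s = \<rho> / 2"
  have s: "0 < s" "s < r" using \<rho> by (auto simp: s_def)
  have hs: "((\<lambda>j. C * (1/2) ^ i * (1/2) ^ j) has_sum (C * (1/2) ^ i * 2)) UNIV" for i :: nat
  proof -
    have "((\<lambda>j. (1/2::real) ^ j) has_sum 2) UNIV"
      using geometric_sums[of "1/2::real"] by (intro norm_summable_imp_has_sum) (auto simp: sums_iff)
    from has_sum_cmult_right[OF this, of "C * (1/2) ^ i"] show ?thesis .
  qed
  have "C \<ge> 0" using C[of 0 0] \<rho> by (simp add: order_trans[OF norm_ge_zero])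
  have "(\<lambda>k. C * (1/2) ^ fst k * (1/2) ^ snd k) summable_on (UNIV \<times> UNIV)"
  proof (rule summable_on_SigmaI)
    show "(\<lambda>i::nat. C * (1/2) ^ i * 2) summable_on UNIV"
      using \<open>C \<ge> 0\<close> by (subst summable_on_UNIV_nonneg_real_iff) (auto intro!: summable_mult summable_mult2)
  qed (use hs \<open>C \<ge> 0\<close> in auto)
  then have S: "(\<lambda>k. C * (1/2) ^ fst k * (1/2) ^ snd k) summable_on (UNIV :: (nat \<times> nat) set)"
    by simp
  have bs: "norm (b i j) * s ^ (i + j) \<le> C * (1/2) ^ i * (1/2) ^ j" for i j
  proof -
    have "norm (b i j) * s ^ (i + j) \<le> C / \<rho> ^ i / \<rho> ^ j * s ^ (i + j)"
      using bb[of i j] s by (intro mult_right_mono) auto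
    also have "\<dots> = C * (1/2) ^ i * (1/2) ^ j"
      using \<rho> by (simp add: s_def power_add power_divide field_simps)
    finally show ?thesis .
  qed
  have "(\<lambda>(i,j). norm (b i j) * s ^ (i + j)) summable_on UNIV"
    by (rule summable_on_comparison_test[OF S]) (use bs s in auto)
  then have "conv2 b" unfolding conv2_def using s by blast
  moreover have "ps2 b x y = F x y" if xy: "x \<in> ball 0 s" "y \<in> ball 0 s" for x y
  proof -
    have "norm (b i j * x ^ i * y ^ j) \<le> C * (1/2) ^ i * (1/2) ^ j" for i j
    proof -
      have "norm (b i j * x ^ i * y ^ j) = norm (b i j) * (norm x ^ i * norm y ^ j)"
        by (simp add: norm_mult norm_power)
      also have "\<dots> \<le> norm (b i j) * (s ^ i * s ^ j)"
        using xy s by (intro mult_left_mono mult_mono power_mono) auto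
      also have "\<dots> \<le> C * (1/2) ^ i * (1/2) ^ j" using bs[of i j] by (simp add: power_add)
      finally show ?thesis .
    qed
    then have "(\<lambda>k. norm ((\<lambda>(i,j). b i j * x ^ i * y ^ j) k)) summable_on UNIV"
      by (intro summable_on_comparison_test[OF S]) auto
    then have sm: "(\<lambda>(i,j). b i j * x ^ i * y ^ j) summable_on (UNIV \<times> UNIV)"
      using abs_summable_summable by auto
    have inner: "((\<lambda>j. b i j * x ^ i * y ^ j) has_sum g i y * x ^ i) UNIV" for i
    proof -
      have "(\<lambda>j. b i j * x ^ i * y ^ j) summable_on UNIV"
        using summable_on_SigmaD1[OF sm, of i] by simp
      then have hsum: "((\<lambda>j. b i j * x ^ i * y ^ j) has_sum infsum (\<lambda>j. b i j * x ^ i * y ^ j) UNIV) UNIV"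
        by (rule has_sum_infsum)
      have "(\<lambda>j. b i j * y ^ j) sums g i y"
        using holomorphic_power_series[OF ghol, of y i] xy s by (simp add: b_def)
      from sums_mult[OF this, of "x ^ i"] have "(\<lambda>j. b i j * x ^ i * y ^ j) sums (g i y * x ^ i)"
        by (simp add: mult_ac)
      with has_sum_imp_sums[OF hsum] hsum show ?thesis by (metis sums_unique2)
    qed
    have "((\<lambda>(i,j). b i j * x ^ i * y ^ j) has_sum ps2 b x y) (UNIV \<times> UNIV)"
      using has_sum_infsum[OF sm] by (simp add: ps2_def)
    then have "((\<lambda>i. g i y * x ^ i) has_sum ps2 b x y) UNIV"
      by (rule has_sum_SigmaD) (use inner in \<open>simp only: prod.case\<close>)
    then have "(\<lambda>i. g i y * x ^ i) sums ps2 b x y" by (rule has_sum_imp_sums)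
    moreover have "(\<lambda>i. g i y * x ^ i) sums F x y"
      using holomorphic_power_series[OF hol2_fst[OF F], of y x] xy s by (simp add: g_def)
    ultimately show ?thesis by (rule sums_unique2)
  qed
  ultimately show ?thesis using that s(1) by blast
qed

section \<open>Real analytic roots\<close>

text \<open>The rows \<open>Y x\<close> list the zeros of \<open>F x\<close> near 0 with
  multiplicity, chosen for each \<open>x\<close> without coherence. Instead of the cofactor only its
  bounds \<open>A\<close> and \<open>B\<close> are exported: they are uniform in \<open>x\<close>,
  which is what a later limit needs.\<close>

lemma hol2_local_roots:
  assumes F: "hol2 F (ball 0 r) (ball 0 r)" and "r > 0"
    and h: "h holomorphic_on ball 0 r" "h 0 \<noteq> 0"
    and F0: "\<And>y. y \<in> ball 0 r \<Longrightarrow> F 0 y = y ^ M * h y"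
  obtains e d A B :: real and Y :: "complex \<Rightarrow> nat \<Rightarrow> complex" where
    "0 < e" "e < r" "0 < d" "d < r" "0 < A"
    "\<And>x i. x \<in> ball 0 d \<Longrightarrow> i < M \<Longrightarrow> Y x i \<in> ball 0 e"
    "\<And>x y. x \<in> ball 0 d \<Longrightarrow> y \<in> cball 0 e \<Longrightarrow> A * (\<Prod>i<M. norm (y - Y x i)) \<le> norm (F x y)"
    "\<And>x y. x \<in> ball 0 d \<Longrightarrow> y \<in> cball 0 e \<Longrightarrow> norm (F x y) \<le> B * (\<Prod>i<M. norm (y - Y x i))"
    "\<And>j. (\<lambda>x. \<Sum>i<M. Y x i ^ j) holomorphic_on ball 0 d"
    "\<And>i. i < M \<Longrightarrow> Y 0 i = 0"
proof -
  have "isCont h 0"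
      by (rule holomorphic_on_ball_isCont_0[OF h(1) \<open>r > 0\<close>])
  from continuous_at_avoid[OF this h(2)] obtain e0 where e0: "e0 > 0" "\<And>y. dist 0 y < e0 \<Longrightarrow> h y \<noteq> 0"
    by auto
  \<comment> \<open>Small enough that \<open>h\<close> has no zero in the closed disc, so that 0 is
    the only zero of \<open>F 0\<close> there when M > 0.\<close>
  define e where "e = min e0 r / 2"
  have e: "0 < e" "e < r" "e < e0" using e0 \<open>r > 0\<close> by (auto simp: e_def min_def)
  have h0: "h y \<noteq> 0" if "y \<in> cball 0 e" for y using e0(2)[of y] that e by auto
  have F0ne: "F 0 y \<noteq> 0" if "y \<in> cball 0 e" "y \<noteq> 0" for y
    using F0[of y] h0[of y] that e by auto
  \<comment> \<open>A closed annulus, not just a circle: once \<open>F x\<close> is zero-free on it,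
    all roots stay in the inner disc of radius e/2 and hence at distance at least e/2 from the outer
    circle.\<close>
  define K where "K = cball (0::complex) e - ball 0 (e/2)"
  have K: "compact K" unfolding K_def by (intro compact_diff) auto
  have Kr: "K \<subseteq> ball 0 r" using e by (auto simp: K_def)
  define W where "W = (ball 0 r \<times> ball 0 r) \<inter> (\<lambda>p. F (fst p) (snd p)) -` (- {0})"
  have openW: "open W" unfolding W_def
    by (rule continuous_open_preimage[OF hol2_continuous[OF F]]) (auto simp: open_Times)
  have "{0} \<times> K \<subseteq> W"
  proof -
    have "0 \<notin> K" using e by (simp add: K_def)
    moreover have "K \<subseteq> cball 0 e" by (auto simp: K_def)
    ultimately show ?thesis using F0ne \<open>r > 0\<close> Kr by (fastforce simp: W_def)
  qed
  from Elementary_Topology.tube_lemma[OF K openW this]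
  obtain X where X: "0 \<in> X" "open X" "X \<times> K \<subseteq> W"
    by (elim exE conjE)
  obtain d0 where d0: "d0 > 0" "cball 0 d0 \<subseteq> X"
    using X(1,2) by (auto simp: open_contains_cball)
  define d where "d = min d0 (r / 2)"
  have d: "0 < d" "d < r" "cball 0 d \<subseteq> X" using d0 \<open>r > 0\<close> by (auto simp: d_def)
  have Fne: "F x y \<noteq> 0" if "x \<in> cball 0 d" "y \<in> K" for x y
  proof -
    have "(x, y) \<in> W" using X(3) d(3) that by blast
    then show ?thesis by (simp add: W_def)
  qed
  have cont: "continuous_on (cball 0 d \<times> K) (\<lambda>p. norm (F (fst p) (snd p)))"
    using d Kr by (intro continuous_on_norm continuous_on_subset[OF hol2_continuous[OF F]]) auto
  have cK: "compact (cball (0::complex) d \<times> K)" "cball (0::complex) d \<times> K \<noteq> {}"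
  proof -
    have "complex_of_real e \<in> K" using e by (simp add: K_def)
    then show "cball (0::complex) d \<times> K \<noteq> {}" using d by auto
  qed (auto intro!: compact_Times K)
  obtain p0 where p0: "p0 \<in> cball 0 d \<times> K"
    "\<And>p. p \<in> cball 0 d \<times> K \<Longrightarrow> norm (F (fst p0) (snd p0)) \<le> norm (F (fst p) (snd p))"
    using continuous_attains_inf[OF cK cont] by blast
  obtain p1 where p1: "p1 \<in> cball 0 d \<times> K"
    "\<And>p. p \<in> cball 0 d \<times> K \<Longrightarrow> norm (F (fst p) (snd p)) \<le> norm (F (fst p1) (snd p1))"
    using continuous_attains_sup[OF cK cont] by blast
  define m0 m1 where "m0 = norm (F (fst p0) (snd p0))" and "m1 = norm (F (fst p1) (snd p1))"
  have m0: "m0 > 0" using Fne p0(1) by (auto simp: m0_def)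
  have m: "m0 \<le> norm (F x y)" "norm (F x y) \<le> m1" if "x \<in> cball 0 d" "y \<in> K" for x y
    using p0(2)[of "(x, y)"] p1(2)[of "(x, y)"] that by (auto simp: m0_def m1_def)

  \<comment> \<open>Bundles the root list with its cofactor, so that both are chosen together for
    each \<open>x\<close>.\<close>
  define P where "P x p \<longleftrightarrow> set (fst p) \<subseteq> ball 0 (e/2) \<and> snd p holomorphic_on ball 0 r \<and>
      (\<forall>y\<in>cball 0 e. snd p y \<noteq> 0) \<and> (\<forall>y\<in>ball 0 r. F x y = (\<Prod>a\<leftarrow>fst p. y - a) * snd p y)" for x p
  have "\<exists>p. P x p" if x: "x \<in> ball 0 d" for x
  proof -
    have hx: "F x holomorphic_on ball 0 r" using hol2_snd[OF F] x d by auto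
    have "F x y \<noteq> 0" if "norm y = e" for y
      using Fne[of x y] x that e by (auto simp: K_def)
    then obtain ys hh where yh: "set ys \<subseteq> ball 0 e" "hh holomorphic_on ball 0 r"
      "\<And>y. y \<in> cball 0 e \<Longrightarrow> hh y \<noteq> 0" "\<And>y. y \<in> ball 0 r \<Longrightarrow> F x y = (\<Prod>a\<leftarrow>ys. y - a) * hh y"
      using holomorphic_factor_cball[OF hx e(1,2)] by metis
    have "a \<in> ball 0 (e/2)" if "a \<in> set ys" for a
    proof -
      have "a \<in> cball 0 e" using that yh(1) by auto
      moreover have "F x a = 0" using yh(4)[of a] yh(1) that e by (force simp: prod_list_zero_iff)
      then have "a \<notin> K" using Fne[of x a] x by auto
      ultimately show ?thesis by (auto simp: K_def)
    qed
    then have "P x (ys, hh)" using yh by (auto simp: P_def)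
    then show ?thesis by blast
  qed
  then obtain p where p: "\<And>x. x \<in> ball 0 d \<Longrightarrow> P x (p x)" by metis
  define ys H where "ys x = fst (p x)" and "H x = snd (p x)" for x
  have ys: "set (ys x) \<subseteq> ball 0 (e/2)" and H: "H x holomorphic_on ball 0 r"
    and H0: "\<And>y. y \<in> cball 0 e \<Longrightarrow> H x y \<noteq> 0"
    and Fx: "\<And>y. y \<in> ball 0 r \<Longrightarrow> F x y = (\<Prod>a\<leftarrow>ys x. y - a) * H x y" if "x \<in> ball 0 d" for x
    using p[OF that] by (auto simp: P_def ys_def H_def)

  define S where "S j x = contour_integral (circlepath 0 e) (\<lambda>y. y ^ j * deriv (F x) y / F x y)" for j x
  have S: "S j x = 2 * pi * \<i> * (\<Sum>a\<leftarrow>ys x. a ^ j)" if x: "x \<in> ball 0 d" for x j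
  proof -
    have "set (ys x) \<subseteq> ball 0 e" using ys[OF x] e by (auto simp: subset_iff)
    from contour_integral_log_deriv_prod[OF H[OF x] e(1,2) H0[OF x] this Fx[OF x]]
    show ?thesis unfolding S_def by (rule contour_integral_unique)
  qed
  have Shol: "S j holomorphic_on ball 0 d" for j
    unfolding S_def
  proof (rule holomorphic_on_contour_integral_circlepath)
    have dF: "hol2 (\<lambda>x. deriv (F x)) (ball 0 r) (ball 0 r)"
      by (rule hol2_deriv_snd[OF F]) auto
    have ne: "F x y \<noteq> 0" if "x \<in> ball 0 d" "y \<in> sphere 0 e" for x y
      using Fne[of x y] that e by (auto simp: K_def)
    show "continuous_on (ball 0 d \<times> sphere 0 e)
         (\<lambda>p. snd p ^ j * deriv (F (fst p)) (snd p) / F (fst p) (snd p))"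
      using d e ne
      by (intro continuous_intros hol2_continuous_compose[OF F] hol2_continuous_compose[OF dF]) auto
    show "(\<lambda>x. w ^ j * deriv (F x) w / F x w) holomorphic_on ball 0 d" if "w \<in> sphere 0 e" for w
      using d e ne that
      by (intro holomorphic_intros holomorphic_on_subset[OF hol2_fst[OF F]]
           holomorphic_on_subset[OF hol2_fst[OF dF]]) auto
  qed (use e in auto)
  \<comment> \<open>The number of roots is the integral for j = 0 up to the factor 2 \<pi> i. It is
    continuous and integer valued on a connected disc, hence constant.\<close>
  have len: "length (ys x) = M" if x: "x \<in> ball 0 d" for x
  proof -
    have sl: "S 0 x = 2 * pi * \<i> * of_nat (length (ys x))" if "x \<in> ball 0 d" for x
      using S[OF that, of 0] by (simp add: map_replicate_const sum_list_replicate)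
    have "continuous_on (ball 0 d) (\<lambda>x. S 0 x / (2 * pi * \<i>))"
      using holomorphic_on_imp_continuous_on[OF Shol] by (intro continuous_intros) auto
    then have "continuous_on (ball 0 d) (\<lambda>x. of_nat (length (ys x)) :: complex)"
      by (rule continuous_on_eq) (use sl in auto)
    then have "(\<lambda>x. of_nat (length (ys x)) :: complex) constant_on ball 0 d"
    proof (rule continuous_discrete_range_constant[OF connected_ball])
      fix x :: complex
      have "1 \<le> norm (of_nat a - of_nat b :: complex)" if "a \<noteq> b" for a b :: nat
      proof -
        have "norm (of_nat a - of_nat b :: complex) = \<bar>real a - real b\<bar>"
          by (metis norm_of_real of_real_diff of_real_of_nat_eq)
        then show ?thesis using that by auto
      qed
      then show "\<exists>e>0. \<forall>y. y \<in> ball 0 d \<and> of_nat (length (ys y)) \<noteq> (of_nat (length (ys x)) :: complex) \<longrightarrow>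
             e \<le> cmod (of_nat (length (ys y)) - of_nat (length (ys x)))"
        by (intro exI[of _ 1]) auto
    qed
    then have l0: "length (ys x) = length (ys 0)"
      using x d(1) unfolding constant_on_def by (metis centre_in_ball of_nat_eq_iff)
    \<comment> \<open>A second factorization of \<open>F 0\<close>, with M roots at 0 and cofactor
      \<open>h\<close>; the same integral evaluated through it shows that the count is M.\<close>
    have "F 0 y = (\<Prod>a\<leftarrow>replicate M 0. y - a) * h y" if "y \<in> ball 0 r" for y
      using F0[OF that] by simp
    moreover have "set (replicate M (0::complex)) \<subseteq> ball 0 e" using e by auto
    ultimately have "((\<lambda>y. y ^ 0 * deriv (F 0) y / F 0 y) has_contour_integral
        2 * pi * \<i> * (\<Sum>a\<leftarrow>replicate M 0. a ^ 0)) (circlepath 0 e)"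
      by (intro contour_integral_log_deriv_prod[OF h(1) e(1,2) h0]) auto
    then    have "S 0 0 = 2 * pi * \<i> * of_nat M"
      unfolding S_def by (intro contour_integral_unique) (simp add: sum_list_replicate)
    then have "length (ys 0) = M" using sl[of 0] d by simp
    with l0 show ?thesis by simp
  qed
  define Y where "Y x i = ys x ! i" for x i
  have Ye: "Y x i \<in> ball 0 (e/2)" if "x \<in> ball 0 d" "i < M" for x i
    using ys[OF that(1)] len[OF that(1)] that(2) nth_mem unfolding Y_def by blast
  have FY: "F x y = (\<Prod>i<M. y - Y x i) * H x y" if "x \<in> ball 0 d" "y \<in> ball 0 r" for x y
    using Fx[OF that] len[OF that(1)]
    by (simp add: prod.list_conv_set_nth Y_def atLeast0LessThan)
  have SY: "S j x = 2 * pi * \<i> * (\<Sum>i<M. Y x i ^ j)" if "x \<in> ball 0 d" for x j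
    using S[OF that] len[OF that] by (simp add: sum_list_sum_nth Y_def atLeast0LessThan)
  have sph: "y \<in> K" "y \<in> ball 0 r" if "norm y = e" for y
    using that e by (auto simp: K_def)
  \<comment> \<open>On the circle |y| = e each factor |y - Y x i| lies between e/2 and 2e, which
    bounds the cofactor on both sides there. The maximum principle for \<open>H x\<close> and for 1
    / \<open>H x\<close> extends the bounds to the disc.\<close>
  define A B where "A = m0 / (2 * e) ^ M" and "B = m1 / (e / 2) ^ M"
  have up: "norm (H x y) \<le> B" if x: "x \<in> ball 0 d" and "y \<in> cball 0 e" for x y
  proof (rule maximum_modulus_frontier[of "H x" "cball 0 e"])
    show "H x holomorphic_on interior (cball 0 e)" "continuous_on (closure (cball 0 e)) (H x)"
      using H[OF x] e by (auto intro!: holomorphic_on_imp_continuous_on elim!: holomorphic_on_subset)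
    fix z assume "z \<in> frontier (cball (0::complex) e)"
    then have z: "norm z = e" using e by simp
    have "(\<Prod>i<M. e / 2) \<le> (\<Prod>i<M. norm (z - Y x i))"
    proof (rule prod_mono)
      fix i assume "i \<in> {..<M}"
      then have "norm (Y x i) < e / 2" using Ye[OF x, of i] by simp
      then show "0 \<le> e / 2 \<and> e / 2 \<le> norm (z - Y x i)"
        using norm_triangle_ineq2[of z "Y x i"] z e by auto
    qed
    then have "(e / 2) ^ M * norm (H x z) \<le> (\<Prod>i<M. norm (z - Y x i)) * norm (H x z)"
      by (intro mult_right_mono) auto
    also have "\<dots> = norm (F x z)" using FY[OF x sph(2)[OF z]] by (simp add: norm_mult prod_norm)
    also have "\<dots> \<le> m1" using m(2)[of x z] x sph(1)[OF z] by auto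
    finally show "norm (H x z) \<le> B" using e by (simp add: B_def field_simps)
  qed (use that in auto)
  have lo: "A \<le> norm (H x y)" if x: "x \<in> ball 0 d" and y: "y \<in> cball 0 e" for x y
  proof -
    have "norm (1 / H x y) \<le> 1 / A"
    proof (rule maximum_modulus_frontier[of "\<lambda>y. 1 / H x y" "cball 0 e"])
      have hh: "H x holomorphic_on cball 0 e"
        using H[OF x] e by (auto elim!: holomorphic_on_subset)
      then have "(\<lambda>y. 1 / H x y) holomorphic_on cball 0 e"
        using H0[OF x] by (intro holomorphic_intros) auto
      then show "(\<lambda>y. 1 / H x y) holomorphic_on interior (cball 0 e)"
        "continuous_on (closure (cball 0 e)) (\<lambda>y. 1 / H x y)"
        by (auto intro!: holomorphic_on_imp_continuous_on elim!: holomorphic_on_subset)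
      fix z assume "z \<in> frontier (cball (0::complex) e)"
      then have z: "norm z = e" using e by simp
      have "m0 \<le> norm (F x z)" using m(1)[of x z] x sph(1)[OF z] by auto
      also have "\<dots> = (\<Prod>i<M. norm (z - Y x i)) * norm (H x z)"
        using FY[OF x sph(2)[OF z]] by (simp add: norm_mult prod_norm)
      also have "\<dots> \<le> (\<Prod>i<M. 2 * e) * norm (H x z)"
      proof (intro mult_right_mono prod_mono)
        fix i assume "i \<in> {..<M}"
        then have "norm (Y x i) < e / 2" using Ye[OF x, of i] by simp
        then show "0 \<le> norm (z - Y x i) \<and> norm (z - Y x i) \<le> 2 * e"
          using norm_triangle_ineq4[of z "Y x i"] z e by auto
      qed auto
      finally have "A \<le> norm (H x z)" using e by (simp add: A_def field_simps)
      moreover have "A > 0" using m0 e by (simp add: A_def)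
      ultimately show "norm (1 / H x z) \<le> 1 / A" by (simp add: norm_divide frac_le)
    qed (use y in auto)
    moreover have "A > 0" using m0 e by (simp add: A_def)
    ultimately show ?thesis using H0[OF x y] by (simp add: norm_divide field_simps)
  qed
  show ?thesis
  proof (rule that[of e d A Y B])
    show "0 < A" using m0 e by (simp add: A_def)
    show "Y x i \<in> ball 0 e" if "x \<in> ball 0 d" "i < M" for x i
      using Ye[OF that] e by auto
    show "A * (\<Prod>i<M. norm (y - Y x i)) \<le> norm (F x y)"
      "norm (F x y) \<le> B * (\<Prod>i<M. norm (y - Y x i))" if "x \<in> ball 0 d" "y \<in> cball 0 e" for x y
    proof -
      have "y \<in> ball 0 r" using that e by auto
      then have *: "norm (F x y) = (\<Prod>i<M. norm (y - Y x i)) * norm (H x y)"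
        using FY[OF that(1)] by (simp add: norm_mult prod_norm)
      show "A * (\<Prod>i<M. norm (y - Y x i)) \<le> norm (F x y)"
        unfolding * using lo[OF that] by (subst mult.commute) (intro mult_left_mono prod_nonneg, auto)
      show "norm (F x y) \<le> B * (\<Prod>i<M. norm (y - Y x i))"
        unfolding * using up[OF that] by (subst (2) mult.commute) (intro mult_left_mono prod_nonneg, auto)
    qed
    show "(\<lambda>x. \<Sum>i<M. Y x i ^ j) holomorphic_on ball 0 d" for j
    proof (rule holomorphic_transform)
      show "(\<lambda>x. S j x / (2 * pi * \<i>)) holomorphic_on ball 0 d"
        using Shol by (intro holomorphic_intros) auto
    qed (use SY in auto)
    show "Y 0 i = 0" if "i < M" for i
    proof -
      have "F 0 (Y 0 i) = (\<Prod>i'<M. Y 0 i - Y 0 i') * H 0 (Y 0 i)"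
        using Ye[of 0 i] that e d by (intro FY) auto
      also have "(\<Prod>i'<M. Y 0 i - Y 0 i') = 0"
        using that by (intro prod_zero) auto
      finally have "F 0 (Y 0 i) = 0" by simp
      moreover have "Y 0 i \<in> cball 0 e" using Ye[of 0 i] that d e by auto
      ultimately show ?thesis using F0ne by blast
    qed
  qed (use e d in auto)
qed

text \<open>For odd \<open>n\<close> the quotient v(x) / x^n changes sign with x. Approaching 0 from
  both sides gives Re w(0) \<ge> 0 and Re w(0) \<le> 0, while Im w(0) = 0 as \<open>w\<close> is
  real at nonzero real points; this contradicts w(0) \<noteq> 0.\<close>

lemma even_order_if_nonneg_on_reals:
  assumes v: "v holomorphic_on ball 0 r" and "r > 0" and ne: "\<exists>x\<in>ball 0 r. v x \<noteq> 0"
    and nn: "\<And>x::real. \<bar>x\<bar> < r \<Longrightarrow> v (of_real x) \<in> \<real> \<and> Re (v (of_real x)) \<ge> 0"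
  obtains k w where "w holomorphic_on ball 0 r" "w 0 \<noteq> 0" "\<And>x. x \<in> ball 0 r \<Longrightarrow> v x = x ^ (2 * k) * w x"
proof -
  obtain n w where w: "w holomorphic_on ball 0 r" "w 0 \<noteq> 0"
    "\<And>x. x \<in> ball 0 r \<Longrightarrow> v x = (x - 0) ^ n * w x"
    using holomorphic_factor_power[OF v open_ball connected_ball _ ne, of 0] \<open>r > 0\<close>
    by (metis centre_in_ball)
  have "even n"
  proof (rule ccontr)
    assume "odd n"
    obtain t where t: "\<And>n. 0 < t n" "\<And>n. t n < r" and t0: "(\<lambda>n. complex_of_real (t n)) \<longlonglongrightarrow> 0"
      by (rule positive_null_sequence[OF \<open>r > 0\<close>]) (rule that)
    have cont: "isCont w 0"
      by (rule holomorphic_on_ball_isCont_0[OF w(1) \<open>r > 0\<close>])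
    have lim1: "(\<lambda>n. w (of_real (t n))) \<longlonglongrightarrow> w 0"
      by (rule isCont_tendsto_compose[OF cont t0])
    have lim2: "(\<lambda>n. w (of_real (- t n))) \<longlonglongrightarrow> w 0"
      by (rule isCont_tendsto_compose[OF cont]) (use tendsto_minus[OF t0] in simp)
    have wx: "w (of_real x) = of_real (Re (v (of_real x)) / x ^ n)" if "\<bar>x\<bar> < r" "x \<noteq> 0" for x
    proof -
      have "v (of_real x) = of_real x ^ n * w (of_real x)" using w(3)[of "of_real x"] that by simp
      moreover have "v (of_real x) = of_real (Re (v (of_real x)))" using nn[OF that(1)] by simp
      ultimately show ?thesis using that by (simp add: field_simps)
    qed
    have w1: "Re (w (of_real (t j))) \<ge> 0" "Im (w (of_real (t j))) = 0" for j
      using wx[of "t j"] nn[of "t j"] t(1,2)[of j] by (auto simp del: of_real_divide)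
    have w2: "Re (w (of_real (- t j))) \<le> 0" for j
      using wx[of "- t j"] nn[of "- t j"] t(1,2)[of j] \<open>odd n\<close>
      by (auto simp del: of_real_divide simp: divide_le_0_iff zero_le_power_eq)
    have "Re (w 0) \<ge> 0" by (rule LIMSEQ_le_const[OF tendsto_Re[OF lim1]]) (use w1 in auto)
    moreover have "Re (w 0) \<le> 0" by (rule LIMSEQ_le_const2[OF tendsto_Re[OF lim2]]) (use w2 in auto)
    moreover have "Im (w 0) = 0"
      using tendsto_Im[OF lim1] by (simp add: w1 LIMSEQ_const_iff)
    ultimately show False using w(2) by (simp add: complex_eq_iff)
  qed
  then obtain k where "n = 2 * k" by (rule evenE)
  then show ?thesis using that[of w k] w by simp
qed

text \<open>The lower bound prevents \<open>f\<close> from vanishing at 0 to a higher order than the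
  product does, that is, more than the number of indices with l_i = 0. The index \<open>i1\<close>
  is not among them, so this number is less than M.\<close>

lemma order_less_if_prod_lower_bound:
  fixes l :: "nat \<Rightarrow> complex"
  assumes f: "f holomorphic_on ball 0 r" and "r > 0" and "A > 0"
    and lo: "\<And>y. y \<in> ball 0 r \<Longrightarrow> A * (\<Prod>i<M. norm (y - l i)) \<le> norm (f y)"
    and i1: "i1 < M" "l i1 \<noteq> 0"
  obtains m g where "m < M" "g holomorphic_on ball 0 r" "g 0 \<noteq> 0" "\<And>y. y \<in> ball 0 r \<Longrightarrow> f y = y ^ m * g y"
proof -
  \<comment> \<open>A disc is infinite, so it contains a point different from all l_i, where the
    lower bound is positive.\<close>
  have "\<exists>y\<in>ball 0 r. f y \<noteq> 0"
  proof -
    have "infinite (ball (0::complex) r)"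
      using finite_imp_not_open[of "ball (0::complex) r"] \<open>r > 0\<close> by auto
    then have "\<not> ball 0 r \<subseteq> l ` {..<M}" using finite_subset by blast
    then obtain y where y: "y \<in> ball 0 r" "y \<notin> l ` {..<M}" by blast
    then have "0 < A * (\<Prod>i<M. norm (y - l i))"
      using \<open>A > 0\<close> by (intro mult_pos_pos prod_pos) auto
    then show ?thesis using lo[OF y(1)] y(1) by (intro bexI[of _ y]) auto
  qed
  then obtain m g where g: "g holomorphic_on ball 0 r" "g 0 \<noteq> 0"
    "\<And>y. y \<in> ball 0 r \<Longrightarrow> f y = (y - 0) ^ m * g y"
    using holomorphic_factor_power[OF f open_ball connected_ball, of 0] \<open>r > 0\<close> by (metis centre_in_ball)
  define I where "I = {i. i < M \<and> l i = 0}"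
  have I: "finite I" "I \<subseteq> {..<M}" by (auto simp: I_def)
  have "I \<subset> {..<M}" using i1 by (auto simp: I_def)
  then have cI: "card I < M" using psubset_card_mono[of "{..<M}" I] by simp
  have "m \<le> card I"
  proof (rule ccontr)
    assume nm: "\<not> m \<le> card I"
    obtain t where t: "\<And>n. 0 < t n" "\<And>n. t n < r" and t0: "t \<longlonglongrightarrow> 0" and tc: "(\<lambda>n. complex_of_real (t n)) \<longlonglongrightarrow> 0"
      by (rule positive_null_sequence[OF \<open>r > 0\<close>]) (rule that)
    have cont: "isCont g 0"
      by (rule holomorphic_on_ball_isCont_0[OF g(1) \<open>r > 0\<close>])
    have "A * (\<Prod>i\<in>{..<M}-I. norm (of_real (t n) - l i)) \<le> t n ^ (m - card I) * norm (g (of_real (t n)))" for n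
    proof -
      have "t n ^ card I * (A * (\<Prod>i\<in>{..<M}-I. norm (of_real (t n) - l i))) =
            A * (\<Prod>i<M. norm (of_real (t n) - l i))"
      proof -
        have "(\<Prod>i\<in>I. norm (of_real (t n) - l i)) = (\<Prod>i\<in>I. t n)"
          by (rule prod.cong) (use t(1)[of n] in \<open>auto simp: I_def\<close>)
        then show ?thesis
          using prod.subset_diff[OF I(2), of "\<lambda>i. norm (of_real (t n) - l i)"] by simp
      qed
      also have "\<dots> \<le> norm (f (of_real (t n)))" using lo[of "of_real (t n)"] t(1,2)[of n] by simp
      also have "\<dots> = t n ^ m * norm (g (of_real (t n)))"
        using g(3)[of "of_real (t n)"] t(1,2)[of n] by (simp add: norm_mult norm_power)
      also have "\<dots> = t n ^ card I * (t n ^ (m - card I) * norm (g (of_real (t n))))"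
        using nm by (simp flip: mult.assoc power_add)
      finally show ?thesis using t(1)[of n] by simp
    qed
    moreover have "(\<lambda>n. A * (\<Prod>i\<in>{..<M}-I. norm (of_real (t n) - l i))) \<longlonglongrightarrow>
        A * (\<Prod>i\<in>{..<M}-I. norm (0 - l i))"
      by (intro tendsto_intros tc)
    moreover have "(\<lambda>n. t n ^ (m - card I) * norm (g (of_real (t n)))) \<longlonglongrightarrow> 0 ^ (m - card I) * norm (g 0)"
      by (intro tendsto_intros t0 isCont_tendsto_compose[OF cont tc])
    ultimately have "A * (\<Prod>i\<in>{..<M}-I. norm (0 - l i)) \<le> 0 ^ (m - card I) * norm (g 0)"
      by (intro LIMSEQ_le) auto
    moreover have "(\<Prod>i\<in>{..<M}-I. norm (0 - l i)) > 0" by (rule prod_pos) (auto simp: I_def)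
    ultimately show False using nm \<open>A > 0\<close> by (simp add: power_0_left mult_le_0_iff)
  qed
  then have "m < M" using cI by simp
  then show ?thesis using that g by simp
qed

text \<open>Rescaling changes the function, the radius and the cofactor, so all three are
  generalized in the induction. The conclusion that \<phi> stays in the disc of radius
  \<open>r\<close> keeps the root supplied by the induction inside the domain where it is
  substituted back.\<close>

lemma real_analytic_root:
  assumes "hol2 F (ball 0 r) (ball 0 r)" and "r > 0"
    and "h holomorphic_on ball 0 r" "h 0 \<noteq> 0"
    and "\<And>y. y \<in> ball 0 r \<Longrightarrow> F 0 y = y ^ M * h y" and "M \<ge> 1"
    and "\<And>(x::real) y. \<bar>x\<bar> < r \<Longrightarrow> y \<in> ball 0 r \<Longrightarrow> y \<notin> \<real> \<Longrightarrow> F (of_real x) y \<noteq> 0"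
  shows "\<exists>\<rho> \<phi>. 0 < \<rho> \<and> \<rho> \<le> r \<and> \<phi> holomorphic_on ball 0 \<rho> \<and> \<phi> 0 = 0 \<and>
      (\<forall>x\<in>ball 0 \<rho>. \<phi> x \<in> ball 0 r \<and> F x (\<phi> x) = 0) \<and>
      (\<forall>x::real. \<bar>x\<bar> < \<rho> \<longrightarrow> \<phi> (of_real x) \<in> \<real>)"
  using assms
proof (induction M arbitrary: F r h rule: less_induct)
  case (less M)
  note F = less.prems(1) and r = less.prems(2) and h = less.prems(3,4) and F0 = less.prems(5)
    and M = less.prems(6) and nonreal = less.prems(7)
  obtain e d A B Y where e: "0 < e" "e < r" and d: "0 < d" "d < r" and A: "0 < A"
    and Ye: "\<And>x i. x \<in> ball 0 d \<Longrightarrow> i < M \<Longrightarrow> Y x i \<in> ball 0 e"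
    and lower: "\<And>x y. x \<in> ball 0 d \<Longrightarrow> y \<in> cball 0 e \<Longrightarrow> A * (\<Prod>i<M. norm (y - Y x i)) \<le> norm (F x y)"
    and upper: "\<And>x y. x \<in> ball 0 d \<Longrightarrow> y \<in> cball 0 e \<Longrightarrow> norm (F x y) \<le> B * (\<Prod>i<M. norm (y - Y x i))"
    and powsum: "\<And>j. (\<lambda>x. \<Sum>i<M. Y x i ^ j) holomorphic_on ball 0 d"
    and Y0: "\<And>i. i < M \<Longrightarrow> Y 0 i = 0"
    by (rule hol2_local_roots[OF F r h F0]) (assumption, rule that)
  have FY: "F x (Y x i) = 0" if "x \<in> ball 0 d" "i < M" for x i
  proof -
    have "(\<Prod>i'<M. norm (Y x i - Y x i')) = 0" using that by (intro prod_zero) auto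
    moreover have "Y x i \<in> cball 0 e" using Ye[OF that] by simp
    ultimately show ?thesis using upper[OF that(1), of "Y x i"] by (simp del: prod_zero_iff)
  qed
  have Yreal: "Y (of_real x) i \<in> \<real>" if "\<bar>x\<bar> < d" "i < M" for x i
  proof (rule ccontr)
    assume "Y (of_real x) i \<notin> \<real>"
    moreover have "Y (of_real x) i \<in> ball 0 r" using Ye[of "of_real x" i] that e by auto
    ultimately show False using nonreal[of x] FY[of "of_real x" i] that d by auto
  qed
  define \<mu> where "\<mu> x = (\<Sum>i<M. Y x i) / of_nat M" for x
  have \<mu>hol: "\<mu> holomorphic_on ball 0 d"
    unfolding \<mu>_def using holomorphic_on_mult[OF powsum[of 1] holomorphic_on_const[of "1 / of_nat M"]] by simp
  have sumY: "(\<Sum>i<M. Y x i) = of_nat M * \<mu> x" for x using M by (simp add: \<mu>_def)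
  have \<mu>0: "\<mu> 0 = 0" using Y0 by (simp add: \<mu>_def)
  have \<mu>real: "\<mu> (of_real x) \<in> \<real>" if "\<bar>x\<bar> < d" for x
    unfolding \<mu>_def using Yreal[OF that] by (intro Reals_divide sum_in_Reals) auto
  define v where "v x = (\<Sum>i<M. (Y x i - \<mu> x)\<^sup>2)" for x
  \<comment> \<open>Expresses \<open>v\<close> through the power sums of exponents 1 and 2, the form
    in which its holomorphy is visible.\<close>
  have v_eq: "v x = (\<Sum>i<M. Y x i ^ 2) - of_nat M * \<mu> x ^ 2" for x
  proof -
    have "v x = (\<Sum>i<M. (Y x i)\<^sup>2 - 2 * \<mu> x * Y x i + (\<mu> x)\<^sup>2)"
      unfolding v_def by (intro sum.cong) (auto simp: power2_eq_square algebra_simps)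
    also have "\<dots> = (\<Sum>i<M. (Y x i)\<^sup>2) - 2 * \<mu> x * (\<Sum>i<M. Y x i) + of_nat M * (\<mu> x)\<^sup>2"
      by (simp add: sum.distrib sum_subtractf sum_distrib_left)
    finally show ?thesis by (simp add: sumY power2_eq_square algebra_simps)
  qed
  have vhol: "v holomorphic_on ball 0 d"
    unfolding v_eq by (intro holomorphic_on_diff powsum holomorphic_intros \<mu>hol)
  \<comment> \<open>Squares of real numbers are squared moduli, so nothing cancels in
    \<open>v\<close> on the real axis and it dominates every single squared deviation.\<close>
  have v_real: "v (of_real x) = of_real (\<Sum>i<M. (norm (Y (of_real x) i - \<mu> (of_real x)))\<^sup>2)"
    if "\<bar>x\<bar> < d" for x
  proof -
    have "(Y (of_real x) i - \<mu> (of_real x))\<^sup>2 = of_real ((norm (Y (of_real x) i - \<mu> (of_real x)))\<^sup>2)" if "i < M" for i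
    proof -
      have "Y (of_real x) i - \<mu> (of_real x) \<in> \<real>" using Yreal[OF \<open>\<bar>x\<bar> < d\<close> that] \<mu>real[OF \<open>\<bar>x\<bar> < d\<close>] by auto
      then show ?thesis by (auto elim!: Reals_cases simp flip: of_real_power)
    qed
    then show ?thesis unfolding v_def by simp
  qed
  show ?case
  proof (cases "\<exists>x\<in>ball 0 d. v x \<noteq> 0")
    case False
    have \<mu>e: "\<mu> x \<in> ball 0 e" if "x \<in> ball 0 d" for x
    proof -
      have "norm (\<Sum>i<M. Y x i) \<le> (\<Sum>i<M. norm (Y x i))" by (rule norm_sum)
      also have "\<dots> < (\<Sum>i<M. e)" using Ye[OF that] M by (intro sum_strict_mono) (auto simp: lessThan_empty_iff)
      finally show ?thesis using M by (simp add: \<mu>_def norm_divide field_simps)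
    qed
    \<comment> \<open>The variable \<open>z\<close> is a dummy: the composition lemma expects an
      inner function of two variables.\<close>
    have "hol2 (\<lambda>x z. F x (\<mu> x)) (ball 0 d) (ball 0 1)"
    proof (rule hol2_compose_snd[OF hol2_subset[OF F]])
      show "hol2 (\<lambda>x z. \<mu> x) (ball 0 d) (ball 0 1)"
        unfolding hol2_def using \<mu>hol
        by (auto intro!: continuous_on_compose2[OF holomorphic_on_imp_continuous_on[OF \<mu>hol]] continuous_intros)
      show "\<mu> x \<in> ball 0 r" if "x \<in> ball 0 d" "z \<in> ball 0 1" for x z
        using \<mu>e[OF that(1)] e by auto
    qed (use d in auto)
    then have Fhol: "(\<lambda>x. F x (\<mu> x)) holomorphic_on ball 0 d"
      using hol2_fst[of _ _ "ball 0 1" 0] by fastforce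
    have "F (of_real x) (\<mu> (of_real x)) = 0" if "\<bar>x\<bar> < d" for x
    proof -
      have "(\<Sum>i<M. (norm (Y (of_real x) i - \<mu> (of_real x)))\<^sup>2) = 0"
        using v_real[OF that] False that by (metis mem_ball_0 norm_of_real of_real_eq_0_iff)
      then have "Y (of_real x) 0 = \<mu> (of_real x)"
        using M by (subst (asm) sum_nonneg_eq_0_iff) auto
      then show ?thesis using FY[of "of_real x" 0] M that by auto
    qed
    then have "F x (\<mu> x) = 0" if "x \<in> ball 0 d" for x
      using holomorphic_zero_on_reals[OF Fhol d(1) _ that] by blast
    then show ?thesis
      using d e \<mu>hol \<mu>0 \<mu>e \<mu>real by (intro exI[of _ d] exI[of _ \<mu>]) fastforce
  next
    case True
    have "v (of_real x) \<in> \<real> \<and> Re (v (of_real x)) \<ge> 0" if "\<bar>x\<bar> < d" for x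
      unfolding v_real[OF that] by (simp add: sum_nonneg)
    then obtain k w where w: "w holomorphic_on ball 0 d" "w 0 \<noteq> 0"
      and vw: "\<And>x. x \<in> ball 0 d \<Longrightarrow> v x = x ^ (2 * k) * w x"
      using even_order_if_nonneg_on_reals[OF vhol d(1) True] by metis
    have "v 0 = 0" using Y0 \<mu>0 by (simp add: v_def)
    \<comment> \<open>All roots coincide at x = 0, so \<open>v\<close> vanishes there; the scaling
      x^k is therefore a genuine contraction.\<close>
    then have k: "k \<ge> 1" using vw[of 0] w(2) d by (cases k) auto
    have "compact (w ` cball 0 (d/2))"
      using d by (intro compact_continuous_image holomorphic_on_imp_continuous_on holomorphic_on_subset[OF w(1)]) auto
    from compact_imp_bounded[OF this] obtain C0 where "\<forall>x\<in>cball 0 (d/2). norm (w x) \<le> C0"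
      by (auto simp: bounded_iff)
    then have C0: "norm (w x) \<le> C0" if "x \<in> cball 0 (d/2)" for x using that by blast
    define C where "C = sqrt C0"
    have "C0 \<ge> 0" using C0[of 0] d norm_ge_zero order_trans by (metis centre_in_cball half_gt_zero less_imp_le)
    then have C: "C \<ge> 0" "C\<^sup>2 = C0" by (auto simp: C_def)
    have dev: "norm (Y (of_real x) i - \<mu> (of_real x)) \<le> C * \<bar>x\<bar> ^ k" if x: "\<bar>x\<bar> < d / 2" and i: "i < M" for x i
    proof (rule power2_le_imp_le)
      have "(norm (Y (of_real x) i - \<mu> (of_real x)))\<^sup>2 \<le> (\<Sum>i<M. (norm (Y (of_real x) i - \<mu> (of_real x)))\<^sup>2)"
        using i by (intro member_le_sum) auto
      also have "\<dots> = norm (v (of_real x))"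
        using v_real[of x] x by (simp add: sum_nonneg del: of_real_sum of_real_power)
      also have "\<dots> = \<bar>x\<bar> ^ (2 * k) * norm (w (of_real x))"
        using vw[of "of_real x"] x by (simp add: norm_mult norm_power)
      also have "\<dots> \<le> \<bar>x\<bar> ^ (2 * k) * C0"
        using C0[of "of_real x"] x by (intro mult_left_mono) auto
      also have "\<dots> = (C * \<bar>x\<bar> ^ k)\<^sup>2"
        by (simp add: power_mult_distrib C(2) power_mult[symmetric] mult.commute)
      finally show "(norm (Y (of_real x) i - \<mu> (of_real x)))\<^sup>2 \<le> (C * \<bar>x\<bar> ^ k)\<^sup>2" .
    qed (use C in auto)
    \<comment> \<open>The rescaled roots have modulus at most \<open>C\<close>; the larger radius
      keeps their limits strictly inside the domain of \<open>q\<close>.\<close>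
    define R where "R = C + 1"
    have R: "R > 0" "C < R" using C by (auto simp: R_def)
    have "isCont \<mu> 0"
      by (rule holomorphic_on_ball_isCont_0[OF \<mu>hol d(1)])
    then obtain d1 where d1: "d1 > 0" "\<And>x. norm x < d1 \<Longrightarrow> norm (\<mu> x) < e / 2"
      unfolding continuous_at_eps_delta using e(1) \<mu>0 by (metis diff_zero dist_norm half_gt_zero)
    \<comment> \<open>The bound 1 together with k \<ge> 1 gives |x^k| \<le> |x|, and e/2/R then
      keeps |x^k z| below e/2; \<open>d1\<close> does the same for the mean, so their sum stays in
      the disc of radius \<open>e\<close>.\<close>
    define D where "D = Min {d / 2, d1, 1, e / 2 / R}"
    have D: "D > 0" "D \<le> d / 2" "D \<le> d1" "D \<le> 1" "D \<le> e / 2 / R"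
      using d d1 e R by (auto simp: D_def)
    have arg: "\<mu> x + x ^ k * z \<in> ball 0 e" if "x \<in> ball 0 D" "z \<in> ball 0 R" for x z
    proof -
      have x: "norm x < D" "norm z < R" using that by auto
      have "norm (x ^ k * z) \<le> norm x * norm z"
      proof -
        have "norm x ^ k \<le> norm x ^ 1" using x D k by (intro power_decreasing) auto
        then show ?thesis by (simp add: norm_mult norm_power mult_right_mono)
      qed
      also have "\<dots> \<le> (e / 2 / R) * R" using x D e R by (intro mult_mono) auto
      also have "\<dots> = e / 2" using R by simp
      finally have "norm (x ^ k * z) \<le> e / 2" .
      moreover have "norm (\<mu> x) < e / 2" using d1(2)[of x] x D by simp
      ultimately show ?thesis using norm_triangle_ineq[of "\<mu> x" "x ^ k * z"] by simp
    qed
    define G where "G x z = F x (\<mu> x + x ^ k * z)" for x z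
    have \<mu>D: "\<mu> holomorphic_on ball 0 D" using D d by (intro holomorphic_on_subset[OF \<mu>hol]) auto
    have G: "hol2 G (ball 0 D) (ball 0 R)"
      unfolding G_def
    proof (rule hol2_compose_snd[OF hol2_subset[OF F]])
      show "hol2 (\<lambda>x z. \<mu> x + x ^ k * z) (ball 0 D) (ball 0 R)"
        unfolding hol2_def
        by (intro conjI ballI continuous_intros holomorphic_intros \<mu>D
            continuous_on_compose2[OF holomorphic_on_imp_continuous_on[OF \<mu>D]]) auto
      show "\<mu> x + x ^ k * z \<in> ball 0 r" if "x \<in> ball 0 D" "z \<in> ball 0 R" for x z
        using arg[OF that] e by auto
    qed (use d D in auto)
    have diff: "norm (\<mu> x + x ^ k * z - Y x i) = norm x ^ k * norm (z - (Y x i - \<mu> x) / x ^ k)"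
      if "x \<noteq> 0" for x z i
    proof -
      have "\<mu> x + x ^ k * z - Y x i = x ^ k * (z - (Y x i - \<mu> x) / x ^ k)"
        using that by (simp add: field_simps)
      then show ?thesis by (simp add: norm_mult norm_power)
    qed
    \<comment> \<open>Each of the M factors of the upper bound is at most (R + C) |x|^k for real x,
      which accounts for the exponent k M.\<close>
    have Gbound: "norm (G (of_real x) z) \<le> \<bar>B\<bar> * (R + C) ^ M * \<bar>x\<bar> ^ (k * M)"
      if x: "\<bar>x\<bar> < D" and z: "z \<in> ball 0 R" for x z
    proof -
      have "norm (G (of_real x) z) \<le> B * (\<Prod>i<M. norm (\<mu> (of_real x) + of_real x ^ k * z - Y (of_real x) i))"
        unfolding G_def using x D d arg[of "of_real x" z] z by (intro upper) auto
      also have "\<dots> \<le> \<bar>B\<bar> * (\<Prod>i<M. (R + C) * \<bar>x\<bar> ^ k)"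
      proof (intro mult_mono prod_mono prod_nonneg)
        fix i assume i: "i \<in> {..<M}"
        have "norm (\<mu> (of_real x) + of_real x ^ k * z - Y (of_real x) i) \<le>
          norm (of_real x ^ k * z) + norm (Y (of_real x) i - \<mu> (of_real x))"
          using norm_triangle_ineq4[of "of_real x ^ k * z" "Y (of_real x) i - \<mu> (of_real x)"]
          by (simp add: algebra_simps)
        also have "\<dots> \<le> \<bar>x\<bar> ^ k * R + C * \<bar>x\<bar> ^ k"
          using dev[of x i] i x D z by (intro add_mono) (auto simp: norm_mult norm_power intro!: mult_left_mono)
        finally show "0 \<le> norm (\<mu> (of_real x) + of_real x ^ k * z - Y (of_real x) i) \<and>
          norm (\<mu> (of_real x) + of_real x ^ k * z - Y (of_real x) i) \<le> (R + C) * \<bar>x\<bar> ^ k"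
          by (simp add: algebra_simps)
      qed (use R C in auto)
      also have "\<dots> = \<bar>B\<bar> * (R + C) ^ M * \<bar>x\<bar> ^ (k * M)"
        by (simp add: power_mult_distrib power_mult)
      finally show ?thesis .
    qed
    \<comment> \<open>Division is carried out for each \<open>z\<close> separately; joint regularity
      of the chosen quotients is recovered afterwards.\<close>
    have "\<exists>qz. qz holomorphic_on ball 0 D \<and> (\<forall>x\<in>ball 0 D. G x z = x ^ (k * M) * qz x)" if z: "z \<in> ball 0 R" for z
      using holomorphic_divide_power[OF hol2_fst[OF G z] D(1) Gbound[OF _ z]] by metis
    then obtain q' where q': "\<And>z. z \<in> ball 0 R \<Longrightarrow> q' z holomorphic_on ball 0 D"
      "\<And>x z. z \<in> ball 0 R \<Longrightarrow> x \<in> ball 0 D \<Longrightarrow> G x z = x ^ (k * M) * q' z x"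
      by metis
    define q where "q x z = q' z x" for x z
    have Gq: "G x z = x ^ (k * M) * q x z" if "x \<in> ball 0 D" "z \<in> ball 0 R" for x z
      using q'(2) that by (simp add: q_def)
    have q: "hol2 q (ball 0 D) (ball 0 R)"
      by (rule hol2_divide_fst_power[OF G _ _ Gq]) (use q'(1) in \<open>auto simp: q_def\<close>)
    define Z where "Z x i = (Y x i - \<mu> x) / x ^ k" for x i
    \<comment> \<open>For x \<noteq> 0 the factor |x|^(k M) occurs on both sides and cancels, so the
      constants \<open>A\<close> and \<open>B\<close> are unchanged by the rescaling.\<close>
    have qbounds: "A * (\<Prod>i<M. norm (z - Z x i)) \<le> norm (q x z)"
      "norm (q x z) \<le> B * (\<Prod>i<M. norm (z - Z x i))"
      if x: "x \<in> ball 0 D" "x \<noteq> 0" and z: "z \<in> ball 0 R" for x z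
    proof -
      have p: "(\<Prod>i<M. norm (\<mu> x + x ^ k * z - Y x i)) = norm x ^ (k * M) * (\<Prod>i<M. norm (z - Z x i))"
        unfolding diff[OF x(2)] Z_def by (simp add: prod.distrib power_mult)
      have n: "norm (F x (\<mu> x + x ^ k * z)) = norm x ^ (k * M) * norm (q x z)"
        using Gq[OF x(1) z] by (simp add: G_def norm_mult norm_power)
      have xd: "x \<in> ball 0 d" "\<mu> x + x ^ k * z \<in> cball 0 e" using x D d arg[OF x(1) z] by auto
      have pos: "norm x ^ (k * M) > 0" using x by simp
      show "A * (\<Prod>i<M. norm (z - Z x i)) \<le> norm (q x z)"
        using lower[OF xd] pos unfolding p n by (simp add: mult.left_commute)
      show "norm (q x z) \<le> B * (\<Prod>i<M. norm (z - Z x i))"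
        using upper[OF xd] pos unfolding p n by (simp add: mult.left_commute)
    qed
    \<comment> \<open>Real points are needed here: only there are the roots known to be real and the
      rescaled roots bounded.\<close>
    obtain t where t: "\<And>n. 0 < t n" "\<And>n. t n < D" and t0: "(\<lambda>n. complex_of_real (t n)) \<longlonglongrightarrow> 0"
      by (rule positive_null_sequence[OF D(1)]) (rule that)
    have ZC: "norm (Z (of_real (t n)) i) \<le> C" if "i < M" for i n
      using dev[of "t n" i] that t(1,2)[of n] D by (simp add: Z_def norm_divide norm_power field_simps)
    then obtain s l where s: "strict_mono s" and l: "\<And>i. i < M \<Longrightarrow> (\<lambda>n. Z (of_real (t (s n))) i) \<longlonglongrightarrow> l i"
      using bounded_sequences_common_subsequence[of M "\<lambda>i n. Z (of_real (t n)) i" C] by auto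
    define x where "x n = complex_of_real (t (s n))" for n
    have xD: "x n \<in> ball 0 D" "x n \<noteq> 0" for n using t(1,2)[of "s n"] by (auto simp: x_def)
    have x0: "x \<longlonglongrightarrow> 0" unfolding x_def using LIMSEQ_subseq_LIMSEQ[OF t0 s] by (simp add: o_def)
    have lx: "(\<lambda>n. Z (x n) i) \<longlonglongrightarrow> l i" if "i < M" for i using l[OF that] by (simp add: x_def)
    have lreal: "l i \<in> \<real>" if "i < M" for i
    proof (rule Lim_in_closed_set[OF closed_complex_Reals _ _ lx[OF that]])
      have "Z (x n) i \<in> \<real>" for n
        unfolding Z_def x_def using t(1,2)[of "s n"] D d that
        by (intro Reals_divide Reals_diff Yreal \<mu>real Reals_power Reals_of_real) auto
      then show "\<forall>\<^sub>F n in sequentially. Z (x n) i \<in> \<real>" by simp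
    qed simp
    have lC: "norm (l i) \<le> C" if "i < M" for i
      by (rule Lim_bounded[OF tendsto_norm[OF lx[OF that]]]) (use ZC[OF that] in \<open>auto simp: x_def\<close>)
    have suml: "(\<Sum>i<M. l i) = 0"
    proof -
      have "(\<Sum>i<M. Z (x n) i) = 0" for n
        by (simp add: Z_def sum_divide_distrib[symmetric] sum_subtractf sumY)
      moreover have "(\<lambda>n. \<Sum>i<M. Z (x n) i) \<longlonglongrightarrow> (\<Sum>i<M. l i)" by (intro tendsto_sum lx) auto
      ultimately show ?thesis by (simp add: LIMSEQ_const_iff)
    qed
    have suml2: "(\<Sum>i<M. (l i)\<^sup>2) = w 0"
    proof -
      have "(\<Sum>i<M. (Z (x n) i)\<^sup>2) = w (x n)" for n
      proof -
        have "(\<Sum>i<M. (Z (x n) i)\<^sup>2) = v (x n) / x n ^ (2 * k)"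
          by (simp add: Z_def v_def power_divide sum_divide_distrib[symmetric] power_mult[symmetric] mult.commute)
        then show ?thesis using vw[of "x n"] xD[of n] D d by auto
      qed
      moreover have "(\<lambda>n. \<Sum>i<M. (Z (x n) i)\<^sup>2) \<longlonglongrightarrow> (\<Sum>i<M. (l i)\<^sup>2)"
        by (intro tendsto_sum tendsto_power lx) auto
      moreover have "isCont w 0"
      by (rule holomorphic_on_ball_isCont_0[OF w(1) d(1)])
      then have "(\<lambda>n. w (x n)) \<longlonglongrightarrow> w 0" by (rule isCont_tendsto_compose[OF _ x0])
      ultimately show ?thesis by (simp add: LIMSEQ_unique)
    qed
    \<comment> \<open>The upper bound makes every l_i a zero of \<open>q 0\<close>, and the lower
      bound limits the order of vanishing there.\<close>
    have qlim: "A * (\<Prod>i<M. norm (z - l i)) \<le> norm (q 0 z)" "norm (q 0 z) \<le> B * (\<Prod>i<M. norm (z - l i))"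
      if z: "z \<in> ball 0 R" for z
    proof -
      have "isCont (\<lambda>x. q x z) 0"
      by (rule holomorphic_on_ball_isCont_0[OF hol2_fst[OF q z] D(1)])
      then have "(\<lambda>n. q (x n) z) \<longlonglongrightarrow> q 0 z" by (rule isCont_tendsto_compose[OF _ x0])
      then have 1: "(\<lambda>n. norm (q (x n) z)) \<longlonglongrightarrow> norm (q 0 z)" by (rule tendsto_norm)
      have 2: "(\<lambda>n. E * (\<Prod>i<M. norm (z - Z (x n) i))) \<longlonglongrightarrow> E * (\<Prod>i<M. norm (z - l i))" for E
        by (intro tendsto_intros lx) auto
      show "A * (\<Prod>i<M. norm (z - l i)) \<le> norm (q 0 z)"
        using qbounds(1)[OF xD z] by (intro LIMSEQ_le[OF 2 1]) auto
      show "norm (q 0 z) \<le> B * (\<Prod>i<M. norm (z - l i))"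
        using qbounds(2)[OF xD z] by (intro LIMSEQ_le[OF 1 2]) auto
    qed
    define c where "c = l 0"
    have c: "c \<in> \<real>" "norm c < R" using lreal[of 0] lC[of 0] M R by (auto simp: c_def)
    have q0c: "q 0 c = 0"
    proof -
      have "(\<Prod>i<M. norm (c - l i)) = 0" using M by (intro prod_zero) (auto simp: c_def)
      then show ?thesis using qlim(2)[of c] c by (simp del: prod_zero_iff)
    qed
    \<comment> \<open>If all limits were equal, their vanishing sum would make them 0, contradicting
      that the sum of their squares is w(0) \<noteq> 0. Subtracting the mean and scaling by exactly
      x^k both serve this point.\<close>
    have "\<exists>i1<M. l i1 \<noteq> c"
    proof (rule ccontr)
      assume "\<not> ?thesis"
      then have eq: "l i = c" if "i < M" for i using that by blast
      then have "of_nat M * c = 0" using suml by simp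
      then have "c = 0" using M by simp
      then show False using suml2 w(2) eq by simp
    qed
    then obtain i1 where i1: "i1 < M" "l i1 - c \<noteq> 0" by auto
    define \<rho>1 where "\<rho>1 = min D (R - norm c)"
    have \<rho>1: "\<rho>1 > 0" "\<rho>1 \<le> D" using D c by (auto simp: \<rho>1_def)
    have cy: "c + y \<in> ball 0 R" if "y \<in> ball 0 \<rho>1" for y
      using that norm_triangle_ineq[of c y] by (auto simp: \<rho>1_def)
    have "(\<lambda>y. c + y) ` ball 0 \<rho>1 \<subseteq> ball 0 R" using cy by blast
    then have q0hol: "(\<lambda>y. q 0 (c + y)) holomorphic_on ball 0 \<rho>1"
      using D(1) by (intro holomorphic_on_compose_gen[OF _ hol2_snd[OF q], unfolded o_def] holomorphic_intros) simp_all
    have q0lower: "A * (\<Prod>i<M. norm (y - (l i - c))) \<le> norm (q 0 (c + y))" if "y \<in> ball 0 \<rho>1" for y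
      using qlim(1)[OF cy[OF that]] by (simp add: algebra_simps)
    obtain m g where m: "m < M" and g: "g holomorphic_on ball 0 \<rho>1" "g 0 \<noteq> 0"
      "\<And>y. y \<in> ball 0 \<rho>1 \<Longrightarrow> q 0 (c + y) = y ^ m * g y"
      by (rule order_less_if_prod_lower_bound[OF q0hol \<rho>1(1) A q0lower i1]) (assumption, rule that)
    have m1: "m \<ge> 1" using g(3)[of 0] g(2) q0c \<rho>1 by (cases m) auto
    have "isCont g 0"
      by (rule holomorphic_on_ball_isCont_0[OF g(1) \<rho>1(1)])
    from continuous_at_avoid[OF this g(2)] obtain e0 where e0: "e0 > 0" "\<And>y. dist 0 y < e0 \<Longrightarrow> g y \<noteq> 0"
      by auto
    \<comment> \<open>Isolates the zero \<open>c\<close> of \<open>q 0\<close>: within this radius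
      \<open>g\<close> does not vanish, which is what the line x = 0 requires below.\<close>
    define \<rho>2 where "\<rho>2 = min e0 \<rho>1"
    have \<rho>2: "\<rho>2 > 0" "\<rho>2 \<le> \<rho>1" using e0 \<rho>1 by (auto simp: \<rho>2_def)
    have "\<exists>\<rho> \<phi>. 0 < \<rho> \<and> \<rho> \<le> \<rho>2 \<and> \<phi> holomorphic_on ball 0 \<rho> \<and> \<phi> 0 = 0 \<and>
      (\<forall>x\<in>ball 0 \<rho>. \<phi> x \<in> ball 0 \<rho>2 \<and> q x (c + \<phi> x) = 0) \<and>
      (\<forall>x::real. \<bar>x\<bar> < \<rho> \<longrightarrow> \<phi> (of_real x) \<in> \<real>)"
    proof (rule less.IH[OF m, of "\<lambda>x y. q x (c + y)" \<rho>2 g])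
      show "hol2 (\<lambda>x y. q x (c + y)) (ball 0 \<rho>2) (ball 0 \<rho>2)"
      proof (rule hol2_compose_snd[OF hol2_subset[OF q]])
        show "hol2 (\<lambda>x y. c + y) (ball 0 \<rho>2) (ball 0 \<rho>2)"
          unfolding hol2_def by (intro conjI ballI continuous_intros holomorphic_intros)
        show "c + z \<in> ball 0 R" if "x \<in> ball 0 \<rho>2" "z \<in> ball 0 \<rho>2" for x z
          using cy[of z] that \<rho>2 by auto
      qed (use \<rho>1 \<rho>2 in auto)
      show "g holomorphic_on ball 0 \<rho>2" using g(1) \<rho>2 by (auto elim!: holomorphic_on_subset)
      show "q 0 (c + y) = y ^ m * g y" if "y \<in> ball 0 \<rho>2" for y using g(3) that \<rho>2 by auto
      show "q (of_real x) (c + y) \<noteq> 0" if x: "\<bar>x\<bar> < \<rho>2" and y: "y \<in> ball 0 \<rho>2" "y \<notin> \<real>" for x y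
      \<comment> \<open>For x \<noteq> 0 the change of variable is real affine with nonzero slope,
        so a nonreal zero of \<open>q\<close> would give one of \<open>F\<close>. At x = 0 the slope
        is 0 and the isolation of \<open>c\<close> is used instead.\<close>
      proof (cases "x = 0")
        case True
        have "y \<noteq> 0" using y(2) by auto
        moreover have "g y \<noteq> 0" using e0(2)[of y] y by (auto simp: \<rho>2_def)
        ultimately show ?thesis using True g(3)[of y] y \<rho>2 by auto
      next
        case False
        have xD: "of_real x \<in> ball (0::complex) D" using x \<rho>1 \<rho>2 by auto
        have cyR: "c + y \<in> ball 0 R" using cy[of y] y \<rho>2 by auto
        have "\<mu> (of_real x) + of_real x ^ k * (c + y) \<notin> \<real>"
        proof
          assume "\<mu> (of_real x) + of_real x ^ k * (c + y) \<in> \<real>"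
          moreover have "\<mu> (of_real x) \<in> \<real>" using \<mu>real[of x] xD D d by auto
          ultimately have "(\<mu> (of_real x) + of_real x ^ k * (c + y) - \<mu> (of_real x)) / of_real x ^ k - c \<in> \<real>"
            using c by (intro Reals_diff Reals_divide Reals_power Reals_of_real)
          then show False using False y(2) by simp
        qed
        moreover have "\<mu> (of_real x) + of_real x ^ k * (c + y) \<in> ball 0 r" using arg[OF xD cyR] e by auto
        ultimately have "G (of_real x) (c + y) \<noteq> 0"
          unfolding G_def using nonreal[of x] xD D d by auto
        then show ?thesis using Gq[OF xD cyR] by auto
      qed
    qed (use \<rho>2 g m1 in auto)
    then obtain \<rho> \<phi> where \<rho>: "0 < \<rho>" "\<rho> \<le> \<rho>2" and \<phi>: "\<phi> holomorphic_on ball 0 \<rho>" "\<phi> 0 = 0"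
      "\<And>x. x \<in> ball 0 \<rho> \<Longrightarrow> \<phi> x \<in> ball 0 \<rho>2" "\<And>x. x \<in> ball 0 \<rho> \<Longrightarrow> q x (c + \<phi> x) = 0"
      "\<And>x::real. \<bar>x\<bar> < \<rho> \<Longrightarrow> \<phi> (of_real x) \<in> \<real>" by blast
    define \<Phi> where "\<Phi> x = \<mu> x + x ^ k * (c + \<phi> x)" for x
    have \<rho>D: "\<rho> \<le> D" using \<rho> \<rho>1 \<rho>2 by simp
    have "\<Phi> holomorphic_on ball 0 \<rho>"
      unfolding \<Phi>_def using \<rho>D by (intro holomorphic_intros \<phi> holomorphic_on_subset[OF \<mu>D]) auto
    moreover have "\<Phi> 0 = 0" using \<mu>0 k by (simp add: \<Phi>_def power_0_left)
    moreover have "\<Phi> x \<in> ball 0 r \<and> F x (\<Phi> x) = 0" if "x \<in> ball 0 \<rho>" for x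
    proof -
      have xD: "x \<in> ball 0 D" using that \<rho>D by auto
      have cR: "c + \<phi> x \<in> ball 0 R" using cy[of "\<phi> x"] \<phi>(3)[OF that] \<rho>2 by auto
      show ?thesis
        using arg[OF xD cR] Gq[OF xD cR] \<phi>(4)[OF that] e by (auto simp: \<Phi>_def G_def)
    qed
    moreover have "\<Phi> (of_real x) \<in> \<real>" if "\<bar>x\<bar> < \<rho>" for x
    proof -
      have "\<mu> (of_real x) \<in> \<real>" using that \<rho>D D d by (intro \<mu>real) simp
      then show ?thesis
        unfolding \<Phi>_def using \<phi>(5)[OF that] c(1) by simp
    qed
    moreover have "\<rho> \<le> r" using \<rho>D D d by simp
    ultimately show ?thesis using \<rho>(1) by blast
  qed
qed

section \<open>Factorization into real analytic branches\<close>

lemma holomorphic_divide_zero: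
  assumes f: "f holomorphic_on ball 0 r" and "r > 0" and "f 0 = 0"
  obtains q where "q holomorphic_on ball 0 r" "\<And>y. y \<in> ball 0 r \<Longrightarrow> f y = y * q y"
proof (cases "\<exists>y\<in>ball 0 r. f y \<noteq> 0")
  case False
  then show ?thesis using that[of "\<lambda>_. 0"] by auto
next
  case True
  then obtain n g where g: "g holomorphic_on ball 0 r" "g 0 \<noteq> 0" "\<And>y. y \<in> ball 0 r \<Longrightarrow> f y = (y - 0) ^ n * g y"
    using holomorphic_factor_power[OF f open_ball connected_ball, of 0] \<open>r > 0\<close> by (metis centre_in_ball)
  have "n \<noteq> 0" using g(2) g(3)[of 0] \<open>f 0 = 0\<close> \<open>r > 0\<close> by (cases n) auto
  then have "f y = y * (y ^ (n - 1) * g y)" if "y \<in> ball 0 r" for y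
    using g(3)[OF that] by (cases n) auto
  moreover have "(\<lambda>y. y ^ (n - 1) * g y) holomorphic_on ball 0 r"
    by (intro holomorphic_intros g)
  ultimately show ?thesis using that by blast
qed

text \<open>Translation by \<phi> straightens the curve to the axis y = 0, so dividing by y -
  \<phi>(x) becomes dividing by a coordinate; translating back gives the quotient.\<close>

lemma hol2_divide_linear:
  assumes F: "hol2 F (ball 0 r) (ball 0 r)" and "r > 0"
    and \<phi>: "\<phi> holomorphic_on ball 0 \<rho>" "\<phi> 0 = 0" and "0 < \<rho>" "\<rho> \<le> r"
    and root: "\<And>x. x \<in> ball 0 \<rho> \<Longrightarrow> F x (\<phi> x) = 0"
  obtains \<delta> Q where "0 < \<delta>" "\<delta> \<le> \<rho>" "hol2 Q (ball 0 \<delta>) (ball 0 \<delta>)"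
    "\<And>x y. x \<in> ball 0 \<delta> \<Longrightarrow> y \<in> ball 0 \<delta> \<Longrightarrow> F x y = (y - \<phi> x) * Q x y"
proof -
  have "isCont \<phi> 0"
      by (rule holomorphic_on_ball_isCont_0[OF \<phi>(1) \<open>0 < \<rho>\<close>])
  then obtain d where d: "d > 0" "\<And>x. norm x < d \<Longrightarrow> norm (\<phi> x) < r / 4"
    unfolding continuous_at_eps_delta using \<open>r > 0\<close> \<phi>(2) by (metis diff_zero dist_norm zero_less_divide_iff zero_less_numeral)
  \<comment> \<open>With |\<phi>| and |y| both below r/4, the translated point y - \<phi>(x) stays
    in the disc of radius r/2 on which the quotient is constructed.\<close>
  define \<delta> where "\<delta> = Min {d, \<rho>, r / 4}"
  have \<delta>: "0 < \<delta>" "\<delta> \<le> d" "\<delta> \<le> \<rho>" "\<delta> \<le> r / 4"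
    using d \<open>0 < \<rho>\<close> \<open>r > 0\<close> by (auto simp: \<delta>_def)
  have \<phi>b: "norm (\<phi> x) < r / 4" if "x \<in> ball 0 \<delta>" for x using d(2)[of x] that \<delta> by auto
  have \<phi>\<delta>: "\<phi> holomorphic_on ball 0 \<delta>" using \<delta> by (intro holomorphic_on_subset[OF \<phi>(1)]) auto
  have G: "hol2 (\<lambda>x y. F x (\<phi> x + y)) (ball 0 \<delta>) (ball 0 (r / 2))"
  proof (rule hol2_compose_snd[OF hol2_subset[OF F]])
    show "hol2 (\<lambda>x y. \<phi> x + y) (ball 0 \<delta>) (ball 0 (r / 2))"
      unfolding hol2_def
      by (intro conjI ballI continuous_intros holomorphic_intros \<phi>\<delta>
          continuous_on_compose2[OF holomorphic_on_imp_continuous_on[OF \<phi>\<delta>]]) auto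
    show "\<phi> x + z \<in> ball 0 r" if "x \<in> ball 0 \<delta>" "z \<in> ball 0 (r / 2)" for x z
      using \<phi>b[OF that(1)] that(2) norm_triangle_ineq[of "\<phi> x" z] \<open>r > 0\<close> by simp
  qed (use \<delta> \<open>\<rho> \<le> r\<close> in auto)
  have "\<exists>qx. qx holomorphic_on ball 0 (r / 2) \<and> (\<forall>y\<in>ball 0 (r / 2). F x (\<phi> x + y) = y * qx y)"
    if x: "x \<in> ball 0 \<delta>" for x
  proof -
    have "F x (\<phi> x + 0) = 0" using root[of x] x \<delta> by auto
    with hol2_snd[OF G x] \<open>r > 0\<close> show ?thesis
      by (metis holomorphic_divide_zero half_gt_zero)
  qed
  then obtain q where q: "\<And>x. x \<in> ball 0 \<delta> \<Longrightarrow> q x holomorphic_on ball 0 (r / 2)"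
    "\<And>x y. x \<in> ball 0 \<delta> \<Longrightarrow> y \<in> ball 0 (r / 2) \<Longrightarrow> F x (\<phi> x + y) = y * q x y"
    by metis
  \<comment> \<open>The arguments are exchanged because the division lemma divides by a power of the
    first one.\<close>
  have "hol2 (\<lambda>y x. q x y) (ball 0 (r / 2)) (ball 0 \<delta>)"
    by (rule hol2_divide_fst_power[OF hol2_flip[OF G], where n = 1]) (use q in auto)
  from hol2_flip[OF this] have q2: "hol2 q (ball 0 \<delta>) (ball 0 (r / 2))" .
  have sm: "y - \<phi> x \<in> ball 0 (r / 2)" if "x \<in> ball 0 \<delta>" "y \<in> ball 0 \<delta>" for x y
    using \<phi>b[OF that(1)] that(2) \<delta> norm_triangle_ineq4[of y "\<phi> x"] by simp
  have "hol2 (\<lambda>x y. q x (y - \<phi> x)) (ball 0 \<delta>) (ball 0 \<delta>)"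
  proof (rule hol2_compose_snd[OF q2])
    show "hol2 (\<lambda>x y. y - \<phi> x) (ball 0 \<delta>) (ball 0 \<delta>)"
      unfolding hol2_def
      by (intro conjI ballI continuous_intros holomorphic_intros \<phi>\<delta>
          continuous_on_compose2[OF holomorphic_on_imp_continuous_on[OF \<phi>\<delta>]]) auto
  qed (use sm in auto)
  moreover have "F x y = (y - \<phi> x) * q x (y - \<phi> x)" if "x \<in> ball 0 \<delta>" "y \<in> ball 0 \<delta>" for x y
    using q(2)[OF that(1) sm[OF that]] by simp
  ultimately show ?thesis using that[of \<delta> "\<lambda>x y. q x (y - \<phi> x)"] \<delta> by simp
qed

text \<open>On the line x = 0 the removed factor is exactly \<open>y\<close>, since \<phi>(0) = 0.
  The quotient therefore has order one less and the same cofactor \<open>h\<close>, which stays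
  fixed in the induction.\<close>

lemma real_analytic_factorization:
  assumes "hol2 F (ball 0 r) (ball 0 r)" and "r > 0"
    and "h holomorphic_on ball 0 r" "h 0 \<noteq> 0"
    and "\<And>y. y \<in> ball 0 r \<Longrightarrow> F 0 y = y ^ M * h y"
    and "\<And>(x::real) y. \<bar>x\<bar> < r \<Longrightarrow> y \<in> ball 0 r \<Longrightarrow> y \<notin> \<real> \<Longrightarrow> F (of_real x) y \<noteq> 0"
  shows "\<exists>\<rho> \<phi> u. 0 < \<rho> \<and> hol2 u (ball 0 \<rho>) (ball 0 \<rho>) \<and> u 0 0 \<noteq> 0 \<and>
      (\<forall>j<M. \<phi> j holomorphic_on ball 0 \<rho> \<and> \<phi> j 0 = 0 \<and> (\<forall>x::real. \<bar>x\<bar> < \<rho> \<longrightarrow> \<phi> j (of_real x) \<in> \<real>)) \<and>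
      (\<forall>x\<in>ball 0 \<rho>. \<forall>y\<in>ball 0 \<rho>. F x y = u x y * (\<Prod>j<M. y - \<phi> j x))"
  using assms
proof (induction M arbitrary: F r)
  case 0
  then have "F 0 0 \<noteq> 0" by simp
  \<comment> \<open>With no roots \<open>F\<close> itself is the unit; the zero family is only a
    filler.\<close>
  then show ?case using 0(1,2) by (intro exI[of _ r] exI[of _ "\<lambda>_ _. 0"] exI[of _ F]) simp
next
  case (Suc M)
  note F = Suc.prems(1) and r = Suc.prems(2) and h = Suc.prems(3,4) and F0 = Suc.prems(5)
    and nonreal = Suc.prems(6)
  from real_analytic_root[OF F r h F0 _ nonreal] obtain \<rho> \<phi> where \<rho>: "0 < \<rho>" "\<rho> \<le> r"
    and \<phi>: "\<phi> holomorphic_on ball 0 \<rho>" "\<phi> 0 = 0" "\<And>x. x \<in> ball 0 \<rho> \<Longrightarrow> F x (\<phi> x) = 0"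
      "\<And>x::real. \<bar>x\<bar> < \<rho> \<Longrightarrow> \<phi> (of_real x) \<in> \<real>"
    by auto
  obtain \<delta> Q where \<delta>: "0 < \<delta>" "\<delta> \<le> \<rho>" and Q: "hol2 Q (ball 0 \<delta>) (ball 0 \<delta>)"
    and FQ: "\<And>x y. x \<in> ball 0 \<delta> \<Longrightarrow> y \<in> ball 0 \<delta> \<Longrightarrow> F x y = (y - \<phi> x) * Q x y"
    by (rule hol2_divide_linear[OF F r \<phi>(1,2) \<rho> \<phi>(3)]) (assumption, rule that)
  have h\<delta>: "h holomorphic_on ball 0 \<delta>" using \<delta> \<rho> by (intro holomorphic_on_subset[OF h(1)]) auto
  have Q0: "Q 0 y = y ^ M * h y" if y: "y \<in> ball 0 \<delta>" for y
  proof -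
    \<comment> \<open>Cancelling \<open>y\<close> settles all y \<noteq> 0; the value at 0 then
      follows by continuity.\<close>
    have *: "Q 0 y - y ^ M * h y = 0" if "y \<in> ball 0 \<delta>" "y \<noteq> 0" for y
    proof -
      have "y * Q 0 y = y * (y ^ M * h y)"
        using FQ[of 0 y] F0[of y] that \<delta> \<rho> \<phi>(2) by (simp add: mult.assoc)
      then show ?thesis using that by simp
    qed
    have Qh: "(\<lambda>y. Q 0 y - y ^ M * h y) holomorphic_on ball 0 \<delta>"
      using \<delta> by (intro holomorphic_intros hol2_snd[OF Q] h\<delta>) auto
    have "Q 0 0 - 0 ^ M * h 0 = 0"
    proof -
      obtain t where t: "\<And>n. 0 < t n" "\<And>n. t n < \<delta>" and t0: "(\<lambda>n. complex_of_real (t n)) \<longlonglongrightarrow> 0"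
        by (rule positive_null_sequence[OF \<delta>(1)]) (rule that)
      have "isCont (\<lambda>y. Q 0 y - y ^ M * h y) 0"
      by (rule holomorphic_on_ball_isCont_0[OF Qh \<delta>(1)])
      from isCont_tendsto_compose[OF this t0]
      have "(\<lambda>n. Q 0 (of_real (t n)) - of_real (t n) ^ M * h (of_real (t n))) \<longlonglongrightarrow> Q 0 0 - 0 ^ M * h 0" .
      moreover have "Q 0 (of_real (t n)) - of_real (t n) ^ M * h (of_real (t n)) = 0" for n
        using t(1,2)[of n] by (intro *) auto
      ultimately show ?thesis by (simp add: LIMSEQ_const_iff)
    qed
    then show ?thesis using *[OF y] by (cases "y = 0") auto
  qed
  have nonrealQ: "Q (of_real x) y \<noteq> 0" if "\<bar>x\<bar> < \<delta>" "y \<in> ball 0 \<delta>" "y \<notin> \<real>" for x y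
    using nonreal[of x y] FQ[of "of_real x" y] that \<delta> \<rho> by auto
  from Suc.IH[OF Q \<delta>(1) h\<delta> h(2) Q0 nonrealQ] obtain \<rho>' \<phi>' u where \<rho>': "0 < \<rho>'"
    and u: "hol2 u (ball 0 \<rho>') (ball 0 \<rho>')" "u 0 0 \<noteq> 0"
    and \<phi>': "\<And>j. j < M \<Longrightarrow> \<phi>' j holomorphic_on ball 0 \<rho>'" "\<And>j. j < M \<Longrightarrow> \<phi>' j 0 = 0"
      "\<And>j x. j < M \<Longrightarrow> \<bar>x\<bar> < \<rho>' \<Longrightarrow> \<phi>' j (of_real x) \<in> \<real>"
    and Qu: "\<And>x y. x \<in> ball 0 \<rho>' \<Longrightarrow> y \<in> ball 0 \<rho>' \<Longrightarrow> Q x y = u x y * (\<Prod>j<M. y - \<phi>' j x)"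
    by blast
  define \<sigma> where "\<sigma> = min \<delta> \<rho>'"
  have \<sigma>: "0 < \<sigma>" "\<sigma> \<le> \<delta>" "\<sigma> \<le> \<rho>'" "\<sigma> \<le> \<rho>" using \<delta> \<rho>' by (auto simp: \<sigma>_def)
  let ?\<phi> = "\<phi>'(M := \<phi>)"
  have "hol2 u (ball 0 \<sigma>) (ball 0 \<sigma>)" using \<sigma> by (intro hol2_subset[OF u(1)]) auto
  moreover have "?\<phi> j holomorphic_on ball 0 \<sigma> \<and> ?\<phi> j 0 = 0 \<and> (\<forall>x::real. \<bar>x\<bar> < \<sigma> \<longrightarrow> ?\<phi> j (of_real x) \<in> \<real>)"
    if "j < Suc M" for j
  proof (cases "j = M")
    case True
    then show ?thesis using \<phi> \<sigma> holomorphic_on_subset[OF \<phi>(1), of "ball 0 \<sigma>"] by auto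
  next
    case False
    then have "j < M" using that by simp
    then show ?thesis
      using \<phi>'[of j] \<sigma> holomorphic_on_subset[OF \<phi>'(1)[of j], of "ball 0 \<sigma>"] by auto
  qed
  moreover have "F x y = u x y * (\<Prod>j<Suc M. y - ?\<phi> j x)" if "x \<in> ball 0 \<sigma>" "y \<in> ball 0 \<sigma>" for x y
  proof -
    have "F x y = (y - \<phi> x) * (u x y * (\<Prod>j<M. y - \<phi>' j x))"
      using FQ[of x y] Qu[of x y] that \<sigma> by auto
    moreover have "(\<Prod>j<M. y - ?\<phi> j x) = (\<Prod>j<M. y - \<phi>' j x)" by (intro prod.cong) auto
    ultimately show ?thesis by (simp add: mult_ac)
  qed
  ultimately show ?case using \<sigma>(1) u(2) by blast
qed

section \<open>The factorization in terms of power series\<close>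

lemma ps2_0_0: "ps2 b 0 0 = b 0 0"
proof -
  have "ps2 b 0 0 = infsum (\<lambda>(i,j). b i j * 0 ^ i * 0 ^ j) {(0, 0)}"
    unfolding ps2_def by (rule infsum_cong_neutral) (auto simp: power_0_left split: if_splits)
  then show ?thesis by simp
qed

theorem theorem3p2:
  fixes a :: "nat \<Rightarrow> nat \<Rightarrow> complex"
  assumes conv: "conv2 a"
    and vanish: "a 0 0 = 0"
    and nontriv: "\<exists>j. a 0 j \<noteq> 0"
    and hyp: "\<exists>U. open U \<and> (0, 0) \<in> U \<and>
               (\<forall>(x::real) (y::complex). (complex_of_real x, y) \<in> U \<and> y \<notin> \<real> \<longrightarrow>
                   ps2 a (complex_of_real x) y \<noteq> 0)"
  shows "\<exists>(b :: nat \<Rightarrow> nat \<Rightarrow> complex) (\<phi> :: nat \<Rightarrow> nat \<Rightarrow> real).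
           conv2 b \<and> b 0 0 \<noteq> 0 \<and>
           (\<forall>j < ord_y0 a. conv1 (\<phi> j) \<and> \<phi> j 0 = 0) \<and>
           (\<exists>V. open V \<and> (0, 0) \<in> V \<and>
              (\<forall>x y. (x, y) \<in> V \<longrightarrow>
                 ps2 a x y = ps2 b x y * (\<Prod>j < ord_y0 a. y - ps1 (\<phi> j) x)))"
proof -
  obtain r1 where r1: "r1 > 0" "hol2 (ps2 a) (ball 0 r1) (ball 0 r1)"
    by (rule conv2_imp_hol2[OF conv]) (rule that)
  obtain r2 h where r2: "r2 > 0" "h holomorphic_on ball 0 r2" "h 0 \<noteq> 0"
    "\<And>y. y \<in> ball 0 r2 \<Longrightarrow> ps2 a 0 y = y ^ ord_y0 a * h y"
    by (rule ps2_0_factor[OF conv nontriv]) (rule that)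
  obtain U where U: "open U" "(0, 0) \<in> U"
    and nonreal: "\<And>(x::real) y. (complex_of_real x, y) \<in> U \<Longrightarrow> y \<notin> \<real> \<Longrightarrow> ps2 a (complex_of_real x) y \<noteq> 0"
    using hyp by blast
  obtain A1 A2 where A: "open A1" "open A2" "0 \<in> A1" "0 \<in> A2" "A1 \<times> A2 \<subseteq> U"
    by (rule open_prod_elim[OF U]) blast
  obtain r3 r4 where r3: "r3 > 0" "ball 0 r3 \<subseteq> A1" and r4: "r4 > 0" "ball 0 r4 \<subseteq> A2"
    using A by (meson open_contains_ball)
  define r where "r = Min {r1, r2, r3, r4}"
  have r: "r > 0" "r \<le> r1" "r \<le> r2" "r \<le> r3" "r \<le> r4"
    using r1 r2 r3 r4 by (auto simp: r_def)
  have F: "hol2 (ps2 a) (ball 0 r) (ball 0 r)"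
    using r by (intro hol2_subset[OF r1(2)]) auto
  have h: "h holomorphic_on ball 0 r"
    using r by (intro holomorphic_on_subset[OF r2(2)]) auto
  have F0: "ps2 a 0 y = y ^ ord_y0 a * h y" if "y \<in> ball 0 r" for y
    using r2(4) that r by auto
  have nr: "ps2 a (of_real x) y \<noteq> 0" if "\<bar>x\<bar> < r" "y \<in> ball 0 r" "y \<notin> \<real>" for x y
  proof -
    have "complex_of_real x \<in> A1" "y \<in> A2" using that r r3 r4 by auto
    then show ?thesis using nonreal[of x y] A(5) that by blast
  qed
  from real_analytic_factorization[OF F r(1) h r2(3) F0 nr]
  obtain \<rho> \<phi> u where \<rho>: "0 < \<rho>" and u: "hol2 u (ball 0 \<rho>) (ball 0 \<rho>)" "u 0 0 \<noteq> 0"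
    and \<phi>: "\<And>j. j < ord_y0 a \<Longrightarrow> \<phi> j holomorphic_on ball 0 \<rho>" "\<And>j. j < ord_y0 a \<Longrightarrow> \<phi> j 0 = 0"
      "\<And>j x. j < ord_y0 a \<Longrightarrow> \<bar>x\<bar> < \<rho> \<Longrightarrow> \<phi> j (of_real x) \<in> \<real>"
    and fac: "\<And>x y. x \<in> ball 0 \<rho> \<Longrightarrow> y \<in> ball 0 \<rho> \<Longrightarrow> ps2 a x y = u x y * (\<Prod>j<ord_y0 a. y - \<phi> j x)"
    by blast
  obtain b s where b: "conv2 b" "s > 0" "\<And>x y. x \<in> ball 0 s \<Longrightarrow> y \<in> ball 0 s \<Longrightarrow> ps2 b x y = u x y"
    by (rule hol2_imp_ps2[OF u(1) \<rho>]) (rule that)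
  \<comment> \<open>The value of the series at the origin is its constant coefficient, so
    nonvanishing of \<open>u\<close> there is a condition on \<open>b\<close>.\<close>
  have "b 0 0 \<noteq> 0" using b(3)[of 0 0] b(2) u(2) by (simp add: ps2_0_0)
  have "\<exists>c. conv1 c \<and> c 0 = 0 \<and> (\<forall>x\<in>ball 0 \<rho>. ps1 c x = \<phi> j x)" if j: "j < ord_y0 a" for j
  proof -
    obtain c where "conv1 c" "complex_of_real (c 0) = \<phi> j 0" "\<And>x. x \<in> ball 0 \<rho> \<Longrightarrow> ps1 c x = \<phi> j x"
      by (rule holomorphic_imp_ps1[OF \<phi>(1)[OF j] \<rho> \<phi>(3)[OF j]]) (assumption, rule that)
    then show ?thesis using \<phi>(2)[OF j] by auto
  qed
  then obtain c where c: "\<And>j. j < ord_y0 a \<Longrightarrow> conv1 (c j)" "\<And>j. j < ord_y0 a \<Longrightarrow> c j 0 = 0"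
    "\<And>j x. j < ord_y0 a \<Longrightarrow> x \<in> ball 0 \<rho> \<Longrightarrow> ps1 (c j) x = \<phi> j x"
    by metis
  define \<sigma> where "\<sigma> = min s \<rho>"
  have \<sigma>: "0 < \<sigma>" "\<sigma> \<le> s" "\<sigma> \<le> \<rho>" using b \<rho> by (auto simp: \<sigma>_def)
  have "ps2 a x y = ps2 b x y * (\<Prod>j < ord_y0 a. y - ps1 (c j) x)"
    if "(x, y) \<in> ball 0 \<sigma> \<times> ball 0 \<sigma>" for x y
  proof -
    have xy: "x \<in> ball 0 \<rho>" "y \<in> ball 0 \<rho>" "x \<in> ball 0 s" "y \<in> ball 0 s" using that \<sigma> by auto
    have "(\<Prod>j < ord_y0 a. y - ps1 (c j) x) = (\<Prod>j < ord_y0 a. y - \<phi> j x)"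
      using c(3)[OF _ xy(1)] by (intro prod.cong) auto
    then show ?thesis using fac[OF xy(1,2)] b(3)[OF xy(3,4)] by simp
  qed
  moreover have "open (ball (0::complex) \<sigma> \<times> ball (0::complex) \<sigma>)" by (simp add: open_Times)
  moreover have "(0, 0) \<in> ball (0::complex) \<sigma> \<times> ball (0::complex) \<sigma>" using \<sigma> by simp
  ultimately show ?thesis using b(1) \<open>b 0 0 \<noteq> 0\<close> c(1,2)
    by (intro exI[of _ b] exI[of _ c] conjI allI impI exI[of _ "ball 0 \<sigma> \<times> ball 0 \<sigma>"]) auto
qed

end
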